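(* Let $\Pi$ be a discrete probability distribution with support $\{s_i : i\in\mathbb{N}\}$, $0<s_1<s_2<\cdots$, probabilities $\pi_i=\Pi(\{s_i\})$, $\sum_{i\ge1}\pi_i=1$, and finite mean $\mu_\Pi$. Let $\xi\ge1$ be an integer, $G_m\sim\mathrm{Erlang}(\xi,\xi)$, and let $\gamma>0$, $\mu_F>0$ with $\gamma\mu_F<1$. Then for all $u\ge0$ the probability of ruin $\psi_{H_\Pi\star\widehat G_m}(u)$ with initial reserve $u$ in the Cramér--Lundberg model with unit premium rate, Poisson intensity $\gamma\mu_F/\mu_\Pi$ and claim size distribution $\Pi\star G_m$ is given by $$\psi_{H_\Pi\star\widehat G_m}(u)=\sum_{n=0}^\infty\kappa_n\frac{(\xi u/s_1)^n e^{-\xi u/s_1}}{n!},$$ where $$\kappa_n=\begin{cases}\gamma\mu_F,& n=0,\\[4pt] (\gamma\mu_F-1)\left(1+\dfrac{\gamma\mu_F s_1}{\mu_\Pi\xi}\right)^n+1,& 1\le n\le\xi,\\[8pt] \dfrac{\gamma\mu_F s_1}{\mu_\Pi\xi}\displaystyle\sum_{i=0}^{n-1}\kappa_{n-1-i}\,\mathcal{C}_i+\dfrac{\gamma\mu_F}{\mu_\Pi}\,\mathcal{D}_n,& n>\xi,\end{cases}$$ and $$\mathcal{C}_i=\sum_{j=1}^\infty\pi_j\,\mathrm{Bin}(\xi-1;i,s_1/s_j),\qquad \mathcal{D}_n=\sum_{j=1}^\infty\pi_j s_j\sum_{k=0}^{\xi-1}\frac{\xi-k}{\xi}\,\mathr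m{bin}(k;n,s_1/s_j).$$
   Context: Cramér--Lundberg model: $R_t=u+t-\sum_{k=1}^{N_t}X_k$, with $N$ a Poisson process and $X_k$ i.i.d. nonnegative claims independent of $N$; the ruin probability is the probability that $R_t<0$ for some $t>0$. By the Pollaczek--Khinchine formula it equals $\psi_H(u)=(1-\rho)\sum_{n\ge1}\rho^n(1-H^{*n}(u))$, where $\rho<1$ is the average claim amount per unit time (intensity times mean claim size; here $\rho=\gamma\mu_F$) and $H$ is the integrated tail distribution of the claims. $\mathrm{Erlang}(\xi,\xi)$ is the Gamma distribution with shape $\xi$ and rate $\xi$. $\Pi\star G(u)=\int_0^\infty G(u/s)\,d\Pi(s)$. The integrated tail of a distribution $G$ with mean $\mu_G$ is $\widehat G(u)=\mu_G^{-1}\int_0^u(1-G(t))\,dt$; the moment distribution of $\Pi$ is $dH_\Pi(s)=s\,d\Pi(s)/\mu_\Pi$; the integrated tail of $\Pi\star G_m$ is $H_\Pi\star\widehat G_m$. $\mathrm{bin}(\cdot;n,p)$ and $\mathrm{Bin}(\cdot;n,p)$ are the probability mass function and the cumulative distribution function of the binomial distribution with parameters $n,p$. Convention $0^0=1$. *)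

theory Defs
  imports "HOL-Probability.Probability"
begin

text \<open>Distributions on the real line are Borel measures, and \<open>cdf\<close> gives their distribution
  functions. Where a distribution is given by a formula for its distribution function, it is the
  associated \<open>interval_measure\<close>.\<close>

definition dist_mean :: "real measure \<Rightarrow> real" where
  "dist_mean G = (\<integral>x. x \<partial>G)"

definition scale_mixture :: "real measure \<Rightarrow> real measure \<Rightarrow> real measure" where
  "scale_mixture P G = interval_measure (\<lambda>u. LINT s:{0<..}|P. cdf G (u / s))"

text \<open>For \<open>u < 0\<close> the interval \<open>{0..u}\<close> is empty and the distribution function vanishes.\<close>

definition integrated_tail :: "real measure \<Rightarrow> real measure" where
  "integrated_tail G = interval_measure (\<lambda>u. (LBINT t:{0..u}. 1 - cdf G t) / dist_mean G)"

definition moment_distribution :: "real measure \<Rightarrow> real measure" where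
  "moment_distribution P = density P (\<lambda>s. ennreal (s / dist_mean P))"

text \<open>The distribution Erlang(\<open>\<xi>\<close>, \<open>\<xi>\<close>) for \<open>\<xi> \<ge> 1\<close>; the first argument of \<open>erlang_density\<close>
  is the shape parameter minus one.\<close>

definition erlang_dist :: "nat \<Rightarrow> real measure" where
  "erlang_dist \<xi> = density lborel (\<lambda>x. ennreal (erlang_density (\<xi> - 1) (real \<xi>) x))"

fun conv_power :: "real measure \<Rightarrow> nat \<Rightarrow> real measure" where
  "conv_power H 0 = return borel 0"
| "conv_power H (Suc n) = convolution H (conv_power H n)"

text \<open>The Pollaczek--Khinchine series; the summation index \<open>n \<ge> 1\<close> is \<open>Suc n\<close> here.\<close>

definition pk_ruin :: "real \<Rightarrow> real measure \<Rightarrow> real \<Rightarrow> real" where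
  "pk_ruin \<rho> H u = (1 - \<rho>) * (\<Sum>n. \<rho> ^ Suc n * (1 - cdf (conv_power H (Suc n)) u))"

text \<open>The Poisson process is given by its inter-arrival times \<open>W 0, W 1, \<dots>\<close>: the \<open>n\<close>-th claim,
  \<open>n \<ge> 1\<close>, arrives at time \<open>W 0 + \<dots> + W (n - 1)\<close> and has size \<open>X (n - 1)\<close>. The set below is
  almost surely finite (on the exceptional null event, \<open>card\<close> gives 0).\<close>

definition claim_number :: "(nat \<Rightarrow> 'a \<Rightarrow> real) \<Rightarrow> real \<Rightarrow> 'a \<Rightarrow> nat" where
  "claim_number W t \<omega> = card {n. 1 \<le> n \<and> (\<Sum>k<n. W k \<omega>) \<le> t}"

definition reserve ::
  "(nat \<Rightarrow> 'a \<Rightarrow> real) \<Rightarrow> (nat \<Rightarrow> 'a \<Rightarrow> real) \<Rightarrow> real \<Rightarrow> real \<Rightarrow> 'a \<Rightarrow> real" where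
  "reserve W X u t \<omega> = u + t - (\<Sum>k<claim_number W t \<omega>. X k \<omega>)"

definition ruin_prob ::
  "'a measure \<Rightarrow> (nat \<Rightarrow> 'a \<Rightarrow> real) \<Rightarrow> (nat \<Rightarrow> 'a \<Rightarrow> real) \<Rightarrow> real \<Rightarrow> real" where
  "ruin_prob M W X u = measure M {\<omega> \<in> space M. \<exists>t>0. reserve W X u t \<omega> < 0}"

text \<open>Joint independence of all \<open>W i\<close> and \<open>X j\<close> says that the \<open>W i\<close> are independent, the \<open>X j\<close>
  are independent, and the arrival process is independent of the claims.\<close>

locale cramer_lundberg = prob_space M for M :: "'a measure" +
  fixes intensity :: real
    and F :: "real measure"
    and W X :: "nat \<Rightarrow> 'a \<Rightarrow> real"
  assumes intensity_pos: "0 < intensity"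
    and indep_W_X: "indep_vars (\<lambda>_. borel) (case_sum W X) UNIV"
    and interarrival_dist: "\<And>k. distributed M lborel (W k) (exponential_density intensity)"
    and claim_dist: "\<And>k. distr M borel (X k) = F"
    and claim_nonneg: "\<And>k. AE \<omega> in M. 0 \<le> X k \<omega>"

definition bin_mass :: "nat \<Rightarrow> nat \<Rightarrow> real \<Rightarrow> real" where
  "bin_mass k n p = pmf (binomial_pmf n p) k"

definition bin_cdf :: "nat \<Rightarrow> nat \<Rightarrow> real \<Rightarrow> real" where
  "bin_cdf k n p = measure_pmf.prob (binomial_pmf n p) {..k}"

text \<open>In the following the atoms are enumerated from index 0, so \<open>s 0\<close> is the smallest atom
  \<open>s\<^sub>1\<close>, and the probability of the atom \<open>s j\<close> is \<open>pmf P (s j)\<close>.\<close>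

definition C_coeff :: "real pmf \<Rightarrow> (nat \<Rightarrow> real) \<Rightarrow> nat \<Rightarrow> nat \<Rightarrow> real" where
  "C_coeff P s \<xi> i = (\<Sum>j. pmf P (s j) * bin_cdf (\<xi> - 1) i (s 0 / s j))"

definition D_coeff :: "real pmf \<Rightarrow> (nat \<Rightarrow> real) \<Rightarrow> nat \<Rightarrow> nat \<Rightarrow> real" where
  "D_coeff P s \<xi> n =
     (\<Sum>j. pmf P (s j) * s j *
        (\<Sum>k=0..\<xi> - 1. (real \<xi> - real k) / real \<xi> * bin_mass k n (s 0 / s j)))"

fun kappa :: "real \<Rightarrow> real \<Rightarrow> real pmf \<Rightarrow> (nat \<Rightarrow> real) \<Rightarrow> nat \<Rightarrow> nat \<Rightarrow> real" where
  "kappa \<gamma> \<mu>\<^sub>F P s \<xi> n =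
     (if n = 0 then \<gamma> * \<mu>\<^sub>F
      else if n \<le> \<xi> then
        (\<gamma> * \<mu>\<^sub>F - 1) * (1 + \<gamma> * \<mu>\<^sub>F * s 0 / (dist_mean P * real \<xi>)) ^ n + 1
      else
        \<gamma> * \<mu>\<^sub>F * s 0 / (dist_mean P * real \<xi>) *
          (\<Sum>i<n. kappa \<gamma> \<mu>\<^sub>F P s \<xi> (n - 1 - i) * C_coeff P s \<xi> i)
        + \<gamma> * \<mu>\<^sub>F / dist_mean P * D_coeff P s \<xi> n)"

declare kappa.simps [simp del]

end

theory Submission imports Defs begin

text \<open>The survival probability \<open>\<phi> = 1 - \<psi>\<close> is the probability that the random walk with steps
  \<open>X k - W k\<close> stays below \<open>u\<close>. Conditioning on the first step and integrating out the exponential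
  waiting time gives the renewal equation
  \<open>\<phi> u = c + (\<integral>x\<in>{0..u}. \<phi> (u - x) * k x)\<close> with \<open>c = \<phi> 0\<close> and \<open>k x = \<lambda> (1 - F x)\<close>, a contraction because
  \<open>\<integral>k = \<rho> < 1\<close>. Its Picard iterates are the partial sums of the Pollaczek--Khinchine series.
  For Erlang mixtures, Poisson thinning writes \<open>k\<close> as a mixture of the functions
  \<open>y\<^sup>n exp (- y) / n!\<close>, \<open>y = \<xi> x / s\<^sub>1\<close>, which are closed under convolution; the recursion for
  \<open>1 - \<kappa>\<^sub>n\<close> is the renewal equation read coefficientwise.\<close>

section \<open>Renewal equations with a contracting kernel\<close>

text \<open>Passing to \<open>1 - \<kappa>\<^sub>n\<close> makes all coefficients nonnegative, so
  the mixture can be integrated term by term in \<open>ennreal\<close>. The scale of the smallest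
  atom makes every ratio \<open>s 0 / s j\<close> a probability, as thinning requires, and gives all
  atoms the same argument \<open>y\<close>. The two formulas for \<open>kappa\<close> at positive
  index are one recursion: \<open>C_coeff\<close> equals 1 below \<open>\<xi>\<close>, which
  produces the geometric closed form, and \<open>D_coeff\<close> is the mean minus a multiple of the
  partial sums of \<open>C_coeff\<close>, which produces the constant term. The contraction serves
  twice, for convergence of the series and for uniqueness. A priori the mixture is bounded only on
  compact intervals, which suffices because the operator at \<open>u\<close> sees only
  \<open>{0..u}\<close>. The constant \<open>\<phi> 0\<close> is not known at the outset: it is
  bounded below through finite horizons and above by letting the reserve grow in the series.\<close>

definition volterra :: "(real \<Rightarrow> real) \<Rightarrow> (real \<Rightarrow> real) \<Rightarrow> real \<Rightarrow> real" where
  "volterra k f u = (LBINT x:{0..u}. f (u - x) * k x)"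

text \<open>Domination by \<open>B * k\<close> on the half-line. A bound on \<open>f\<close> is
  asked for on \<open>{0..u}\<close> only, since Poisson mixtures are controlled a priori only on
  compact intervals.\<close>

lemma set_integrable_volterra:
  fixes k f :: "real \<Rightarrow> real"
  assumes [measurable]: "k \<in> borel_measurable borel" "f \<in> borel_measurable borel"
    and k: "set_integrable lborel {0..} k"
    and f: "\<And>v. 0 \<le> v \<Longrightarrow> v \<le> u \<Longrightarrow> \<bar>f v\<bar> \<le> B"
  shows "set_integrable lborel {0..u} (\<lambda>x. f (u - x) * k x)"
  unfolding set_integrable_def
proof (rule Bochner_Integration.integrable_bound)
  show "integrable lborel (\<lambda>x. B * (indicator {0..} x *\<^sub>R k x))"
    using k unfolding set_integrable_def by (rule integrable_mult_right)
  show "AE x in lborel. norm (indicator {0..u} x *\<^sub>R (f (u - x) * k x))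
      \<le> norm (B * (indicator {0..} x *\<^sub>R k x))"
  proof (rule AE_I2)
    fix x
    have "\<bar>f (u - x) * k x\<bar> \<le> \<bar>B * k x\<bar>" if "x \<in> {0..u}"
      using f[of "u - x"] that unfolding abs_mult by (intro mult_right_mono) auto
    then show "norm (indicator {0..u} x *\<^sub>R (f (u - x) * k x)) \<le> norm (B * (indicator {0..} x *\<^sub>R k x))"
      by (simp add: indicator_def)
  qed
qed measurable

text \<open>For \<open>x\<close> in \<open>{0..v}\<close> the argument \<open>v - x\<close> stays in
  \<open>{0..U}\<close>, so a sup bound on that interval reproduces itself at each step with the
  mass of \<open>k\<close> as extra factor.\<close>

lemma volterra_contraction:
  fixes k :: "real \<Rightarrow> real" and d :: "nat \<Rightarrow> real \<Rightarrow> real"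
  assumes [measurable]: "k \<in> borel_measurable borel" "\<And>n. d n \<in> borel_measurable borel"
    and k_nonneg: "\<And>x. 0 \<le> k x" and k: "set_integrable lborel {0..} k"
    and \<rho>: "(LBINT x:{0..}. k x) \<le> \<rho>"
    and d_0: "\<And>v. 0 \<le> v \<Longrightarrow> v \<le> U \<Longrightarrow> \<bar>d 0 v\<bar> \<le> B"
    and d_Suc: "\<And>n v. 0 \<le> v \<Longrightarrow> v \<le> U \<Longrightarrow> d (Suc n) v = volterra k (d n) v"
    and v: "0 \<le> v" "v \<le> U"
  shows "\<bar>d n v\<bar> \<le> B * \<rho> ^ n"
  using v
proof (induction n arbitrary: v)
  case 0
  then show ?case using d_0 by simp
next
  case (Suc n)
  have "0 \<le> B" using d_0[OF Suc.prems] by linarith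
  have "0 \<le> (LBINT x:{0..}. k x)"
    unfolding set_lebesgue_integral_def by (intro Bochner_Integration.integral_nonneg) (auto simp: k_nonneg)
  then have "0 \<le> \<rho>" using \<rho> by linarith
  have bound: "\<bar>d n w\<bar> \<le> B * \<rho> ^ n" if "0 \<le> w" "w \<le> v" for w
    using that Suc.prems by (intro Suc.IH) auto
  have "\<bar>d (Suc n) v\<bar> \<le> (\<integral>x. (B * \<rho> ^ n) * (indicator {0..} x *\<^sub>R k x) \<partial>lborel)"
    unfolding d_Suc[OF Suc.prems] volterra_def set_lebesgue_integral_def
  proof (rule integral_abs_bound_integral)
    show "integrable lborel (\<lambda>x. indicator {0..v} x *\<^sub>R (d n (v - x) * k x))"
      using set_integrable_volterra[OF assms(1,2) k bound] unfolding set_integrable_def by blast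
    show "integrable lborel (\<lambda>x. (B * \<rho> ^ n) * (indicator {0..} x *\<^sub>R k x))"
      using k unfolding set_integrable_def by (rule integrable_mult_right)
    fix x
    have "\<bar>d n (v - x) * k x\<bar> \<le> (B * \<rho> ^ n) * k x" if "x \<in> {0..v}"
      using bound[of "v - x"] that k_nonneg[of x] unfolding abs_mult by (intro mult_mono) auto
    then show "\<bar>indicator {0..v} x *\<^sub>R (d n (v - x) * k x)\<bar> \<le> (B * \<rho> ^ n) * (indicator {0..} x *\<^sub>R k x)"
      using k_nonneg[of x] \<open>0 \<le> B\<close> \<open>0 \<le> \<rho>\<close> by (cases "x \<in> {0..v}") (simp_all add: indicator_def)
  qed
  also have "\<dots> = (B * \<rho> ^ n) * (LBINT x:{0..}. k x)"
    unfolding set_lebesgue_integral_def by simp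
  also have "\<dots> \<le> (B * \<rho> ^ n) * \<rho>"
    using \<rho> \<open>0 \<le> B\<close> \<open>0 \<le> \<rho>\<close> by (intro mult_left_mono) auto
  finally show ?case by (simp add: mult_ac)
qed

lemma volterra_diff:
  assumes "k \<in> borel_measurable borel" "f \<in> borel_measurable borel" "g \<in> borel_measurable borel"
    and "set_integrable lborel {0..} k"
    and "\<And>v. 0 \<le> v \<Longrightarrow> v \<le> u \<Longrightarrow> \<bar>f v\<bar> \<le> B" "\<And>v. 0 \<le> v \<Longrightarrow> v \<le> u \<Longrightarrow> \<bar>g v\<bar> \<le> B'"
  shows "volterra k (\<lambda>v. f v - g v) u = volterra k f u - volterra k g u"
  unfolding volterra_def left_diff_distrib
  by (rule set_integral_diff; rule set_integrable_volterra) (use assms in auto)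

text \<open>The error \<open>g n - f\<close> obeys the homogeneous equation, so \<open>c\<close>
  drops out and the decay is geometric. For a constant sequence \<open>g\<close> this becomes
  uniqueness among solutions bounded on \<open>{0..u}\<close>.\<close>

lemma picard_iteration_tendsto:
  fixes k f :: "real \<Rightarrow> real" and g :: "nat \<Rightarrow> real \<Rightarrow> real"
  assumes [measurable]: "k \<in> borel_measurable borel" "f \<in> borel_measurable borel"
      "\<And>n. g n \<in> borel_measurable borel"
    and k_nonneg: "\<And>x. 0 \<le> k x" and k: "set_integrable lborel {0..} k"
    and k_mass: "(LBINT x:{0..}. k x) < 1"
    and f: "\<And>v. 0 \<le> v \<Longrightarrow> v \<le> u \<Longrightarrow> f v = c + volterra k f v"
    and f_bound: "\<And>v. 0 \<le> v \<Longrightarrow> v \<le> u \<Longrightarrow> \<bar>f v\<bar> \<le> B"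
    and g: "\<And>n v. 0 \<le> v \<Longrightarrow> v \<le> u \<Longrightarrow> g (Suc n) v = c + volterra k (g n) v"
    and g_bound: "\<And>n v. 0 \<le> v \<Longrightarrow> v \<le> u \<Longrightarrow> \<bar>g n v\<bar> \<le> B'"
    and u: "0 \<le> u"
  shows "(\<lambda>n. g n u) \<longlonglongrightarrow> f u"
proof -
  define \<rho> where "\<rho> = (LBINT x:{0..}. k x)"
  have "0 \<le> \<rho>"
    unfolding \<rho>_def set_lebesgue_integral_def
    by (intro Bochner_Integration.integral_nonneg) (auto simp: k_nonneg)
  have "\<bar>g n u - f u\<bar> \<le> (B' + B) * \<rho> ^ n" for n
  proof (rule volterra_contraction[where k = k and d = "\<lambda>n v. g n v - f v" and U = u])
    show "\<bar>g 0 v - f v\<bar> \<le> B' + B" if "0 \<le> v" "v \<le> u" for v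
      using f_bound[OF that] g_bound[OF that, of 0] by linarith
    show "g (Suc n) v - f v = volterra k (\<lambda>v. g n v - f v) v" if "0 \<le> v" "v \<le> u" for n v
    proof -
      have "volterra k (\<lambda>v. g n v - f v) v = volterra k (g n) v - volterra k f v"
        by (rule volterra_diff[where B = B' and B' = B])
          (use that f_bound g_bound[of _ n] k in auto)
      then show ?thesis using f[OF that] g[OF that] by simp
    qed
  qed (use u k_nonneg k in \<open>auto simp: \<rho>_def\<close>)
  moreover have "(\<lambda>n. (B' + B) * \<rho> ^ n) \<longlonglongrightarrow> 0"
    using k_mass \<open>0 \<le> \<rho>\<close> by (intro tendsto_mult_right_zero LIMSEQ_realpow_zero) (auto simp: \<rho>_def)
  ultimately have "(\<lambda>n. g n u - f u) \<longlonglongrightarrow> 0"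
    using Lim_null_comparison[of "\<lambda>n. g n u - f u" "\<lambda>n. (B' + B) * \<rho> ^ n"] by simp
  then show ?thesis by (simp add: LIM_zero_iff)
qed

section \<open>Scale mixtures and integrated tails\<close>

lemma borel_measurable_cdf:
  assumes "real_distribution G"
  shows "cdf G \<in> borel_measurable borel"
  by (intro borel_measurable_mono monoI finite_borel_measure.cdf_nondecreasing
      real_distribution.finite_borel_measure_M assms)

text \<open>The way out of definitions by a distribution function: once some measure is shown to
  have the given cdf, the \<open>interval_measure\<close> is that measure.\<close>

lemma interval_measure_cdf:
  assumes "real_distribution D"
  shows "interval_measure (cdf D) = D"
proof -
  interpret real_distribution D by fact
  have "real_distribution (interval_measure (cdf D))"
    by (rule real_distribution_interval_measure)
      (auto intro: cdf_nondecreasing cdf_is_right_cont cdf_lim_at_bot cdf_lim_at_top_prob)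
  moreover have "cdf (interval_measure (cdf D)) = cdf D"
    by (rule cdf_interval_measure) (auto intro: cdf_nondecreasing cdf_is_right_cont cdf_lim_at_bot)
  ultimately show ?thesis using assms cdf_unique by blast
qed

text \<open>Only the identity has to be measurable, because the intended instance
  \<open>measure_pmf P\<close> carries the discrete sigma-algebra and not the Borel one.\<close>

locale positive_mixing = prob_space Q for Q :: "real measure" +
  assumes id_measurable [measurable]: "(\<lambda>s. s) \<in> borel_measurable Q"
    and pos: "AE s in Q. 0 < s"
begin

text \<open>The mixture is the law of a product of independent factors \<open>s\<close> and
  \<open>x\<close>: for \<open>s > 0\<close> the product is at most \<open>u\<close> iff
  \<open>x \<le> u / s\<close>, and Tonelli averages over \<open>s\<close>. Almost sure positivity
  also makes the restriction to \<open>{0<..}\<close> in the definition harmless.\<close>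

lemma
  assumes "real_distribution G"
  shows real_distribution_scale_mixture: "real_distribution (scale_mixture Q G)"
    and cdf_scale_mixture: "cdf (scale_mixture Q G) u = (\<integral>s. cdf G (u / s) \<partial>Q)"
    and scale_mixture_eq_distr: "scale_mixture Q G = distr (Q \<Otimes>\<^sub>M G) borel (\<lambda>(s, x). s * x)"
proof -
  interpret G: real_distribution G by fact
  interpret QG: pair_prob_space Q G ..
  note [measurable] = borel_measurable_cdf[OF assms]
  have [measurable]: "(\<lambda>(s, x). s * x) \<in> borel_measurable (Q \<Otimes>\<^sub>M G)"
    by measurable
  define D where "D = distr (Q \<Otimes>\<^sub>M G) borel (\<lambda>(s, x). s * x)"
  interpret D: real_distribution D unfolding D_def by (rule QG.real_distribution_distr) measurable
  have cdf_D: "cdf D u = (\<integral>s. cdf G (u / s) \<partial>Q)" for u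
  proof -
    have "ennreal (cdf D u) = emeasure (Q \<Otimes>\<^sub>M G) ((\<lambda>(s, x). s * x) -` {..u} \<inter> space (Q \<Otimes>\<^sub>M G))"
      unfolding cdf_def D.emeasure_eq_measure[symmetric] by (simp add: D_def emeasure_distr)
    also have "\<dots> = (\<integral>\<^sup>+s. emeasure G (Pair s -` ((\<lambda>(s, x). s * x) -` {..u} \<inter> space (Q \<Otimes>\<^sub>M G))) \<partial>Q)"
      by (rule G.emeasure_pair_measure_alt) measurable
    also have "\<dots> = (\<integral>\<^sup>+s. ennreal (cdf G (u / s)) \<partial>Q)"
      using pos AE_space[of Q]
    proof (intro nn_integral_cong_AE, eventually_elim)
      case (elim s)
      then have "Pair s -` ((\<lambda>(s, x). s * x) -` {..u} \<inter> space (Q \<Otimes>\<^sub>M G)) = {..u / s}"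
        by (auto simp: space_pair_measure field_simps)
      then show ?case
        by (simp add: G.emeasure_eq_measure cdf_def)
    qed
    also have "\<dots> = ennreal (\<integral>s. cdf G (u / s) \<partial>Q)"
      by (intro nn_integral_eq_integral integrable_const_bound[where B = 1])
        (auto simp: G.cdf_nonneg G.cdf_bounded_prob)
    finally show ?thesis
      by (subst (asm) ennreal_inj) (auto simp: D.cdf_nonneg G.cdf_nonneg intro!: Bochner_Integration.integral_nonneg)
  qed
  have "(LINT s:{0<..}|Q. cdf G (u / s)) = (\<integral>s. cdf G (u / s) \<partial>Q)" for u
    unfolding set_lebesgue_integral_def
    by (intro integral_cong_AE) (use pos in \<open>auto elim!: eventually_mono\<close>)
  then have "(\<lambda>u. LINT s:{0<..}|Q. cdf G (u / s)) = cdf D" by (simp add: cdf_D fun_eq_iff)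
  then have "scale_mixture Q G = interval_measure (cdf D)" by (simp add: scale_mixture_def)
  also have "\<dots> = D" by (rule interval_measure_cdf) (rule D.real_distribution_axioms)
  finally have *: "scale_mixture Q G = D" .
  show "real_distribution (scale_mixture Q G)" unfolding * ..
  show "cdf (scale_mixture Q G) u = (\<integral>s. cdf G (u / s) \<partial>Q)" unfolding * by (rule cdf_D)
  show "scale_mixture Q G = distr (Q \<Otimes>\<^sub>M G) borel (\<lambda>(s, x). s * x)" unfolding * D_def ..
qed

lemma
  assumes G: "real_distribution G" and "integrable Q (\<lambda>s. s)" "integrable G (\<lambda>x. x)"
  shows integrable_scale_mixture: "integrable (scale_mixture Q G) (\<lambda>x. x)"
    and dist_mean_scale_mixture: "dist_mean (scale_mixture Q G) = dist_mean Q * dist_mean G"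
proof -
  interpret G: real_distribution G by fact
  interpret QG: pair_prob_space Q G ..
  have [measurable]: "(\<lambda>(s, x). s * x) \<in> borel_measurable (Q \<Otimes>\<^sub>M G)"
    by measurable
  have int: "integrable (Q \<Otimes>\<^sub>M G) (\<lambda>(s, x). s * x)"
  proof (rule QG.Fubini_integrable)
    show "integrable Q (\<lambda>s. \<integral>x. norm (case (s, x) of (s, x) \<Rightarrow> s * x) \<partial>G)"
      using assms(2) by (simp add: abs_mult)
    show "AE s in Q. integrable G (\<lambda>x. case (s, x) of (s, x) \<Rightarrow> s * x)"
      using assms(3) by simp
  qed measurable
  then show "integrable (scale_mixture Q G) (\<lambda>x. x)"
    unfolding scale_mixture_eq_distr[OF G] by (subst integrable_distr_eq) (auto simp: split_beta')
  have "dist_mean (scale_mixture Q G) = (\<integral>z. (case z of (s, x) \<Rightarrow> s * x) \<partial>(Q \<Otimes>\<^sub>M G))"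
    unfolding dist_mean_def scale_mixture_eq_distr[OF G] by (subst integral_distr) auto
  also have "\<dots> = (\<integral>s. \<integral>x. s * x \<partial>G \<partial>Q)"
    using QG.integral_fst'[OF int] by simp
  finally show "dist_mean (scale_mixture Q G) = dist_mean Q * dist_mean G"
    by (simp add: dist_mean_def)
qed

end

locale nonneg_distribution = real_distribution G for G :: "real measure" +
  assumes nonneg: "AE x in G. 0 \<le> x"
    and integrable_id: "integrable G (\<lambda>x. x)"
    and mean_pos: "0 < dist_mean G"
begin

lemma measurable_cdf [measurable]: "cdf G \<in> borel_measurable borel"
  by (rule borel_measurable_cdf) (rule real_distribution_axioms)

text \<open>Layer-cake formula: Tonelli for the region \<open>0 \<le> t < x\<close>, whose section
  at \<open>x\<close> has length \<open>x\<close>.\<close>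

lemma nn_integral_tail: "(\<integral>\<^sup>+t. ennreal (1 - cdf G t) * indicator {0..} t \<partial>lborel) = ennreal (dist_mean G)"
proof -
  interpret P: pair_sigma_finite G lborel ..
  have tail: "ennreal (1 - cdf G t) = (\<integral>\<^sup>+x. indicator {t<..} x \<partial>G)" for t
  proof -
    have "1 - cdf G t = prob (space G - {..t})"
      unfolding cdf_def by (subst prob_compl) auto
    also have "space G - {..t} = {t<..}" by auto
    finally show ?thesis by (simp add: emeasure_eq_measure)
  qed
  have "(\<integral>\<^sup>+t. ennreal (1 - cdf G t) * indicator {0..} t \<partial>lborel)
      = (\<integral>\<^sup>+t. \<integral>\<^sup>+x. indicator {(t, x). 0 \<le> t \<and> t < x} (t, x) \<partial>G \<partial>lborel)"
    unfolding tail by (subst nn_integral_multc[symmetric]) (auto simp: indicator_def intro!: nn_integral_cong)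
  also have "\<dots> = (\<integral>\<^sup>+x. \<integral>\<^sup>+t. indicator {(t, x). 0 \<le> t \<and> t < x} (t, x) \<partial>lborel \<partial>G)"
    by (rule P.Fubini') measurable
  also have "\<dots> = (\<integral>\<^sup>+x. ennreal x \<partial>G)"
    using nonneg
  proof (intro nn_integral_cong_AE, eventually_elim)
    case (elim x)
    have "(\<integral>\<^sup>+t. indicator {(t, x). 0 \<le> t \<and> t < x} (t, x) \<partial>lborel) = (\<integral>\<^sup>+t. indicator {0..<x} t \<partial>lborel)"
      by (intro nn_integral_cong) (auto simp: indicator_def)
    then show ?case using elim by simp
  qed
  also have "\<dots> = ennreal (dist_mean G)"
    unfolding dist_mean_def by (rule nn_integral_eq_integral[OF integrable_id nonneg])
  finally show ?thesis .
qed

lemma tail_set_integrable: "set_integrable lborel {0..} (\<lambda>t. 1 - cdf G t)"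
  and tail_set_integral: "(LBINT t:{0..}. 1 - cdf G t) = dist_mean G"
proof -
  have *: "has_bochner_integral lborel (\<lambda>t. indicator {0..} t *\<^sub>R (1 - cdf G t)) (dist_mean G)"
  proof (rule has_bochner_integral_nn_integral)
    have "ennreal (indicator {0..} t *\<^sub>R (1 - cdf G t)) = ennreal (1 - cdf G t) * indicator {0..} t" for t :: real
      by (auto simp: indicator_def)
    then show "(\<integral>\<^sup>+t. ennreal (indicator {0..} t *\<^sub>R (1 - cdf G t)) \<partial>lborel) = ennreal (dist_mean G)"
      using nn_integral_tail by simp
  qed (use mean_pos in \<open>auto simp: cdf_bounded_prob\<close>)
  from * show "set_integrable lborel {0..} (\<lambda>t. 1 - cdf G t)"
    unfolding set_integrable_def by (rule integrable.intros)
  from * show "(LBINT t:{0..}. 1 - cdf G t) = dist_mean G"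
    unfolding set_lebesgue_integral_def by (rule has_bochner_integral_integral_eq)
qed

text \<open>The tail over the mean has total mass 1 by \<open>nn_integral_tail\<close>, and its cdf
  is the defining formula. Later integrals against integrated tails go through this density.\<close>

lemma integrated_tail_eq_density:
  "integrated_tail G = density lborel (\<lambda>t. ennreal ((1 - cdf G t) / dist_mean G) * indicator {0..} t)"
  and real_distribution_integrated_tail: "real_distribution (integrated_tail G)"
proof -
  define D where "D = density lborel (\<lambda>t. ennreal ((1 - cdf G t) / dist_mean G) * indicator {0..} t)"
  have density_eq: "ennreal ((1 - cdf G t) / dist_mean G) * indicator {0..} t
      = ennreal (inverse (dist_mean G)) * (ennreal (1 - cdf G t) * indicator {0..} t)" for t
    using mean_pos cdf_bounded_prob[of t]
    by (auto simp: indicator_def ennreal_mult'[symmetric] field_simps)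
  interpret D: prob_space D
  proof
    show "emeasure D (space D) = 1"
      using mean_pos
      by (simp add: D_def emeasure_density density_eq nn_integral_cmult nn_integral_tail
          ennreal_mult'[symmetric])
  qed
  interpret D: real_distribution D
    by standard (simp add: D_def)
  have "cdf D u = (LBINT t:{0..u}. 1 - cdf G t) / dist_mean G" for u
  proof -
    have "set_integrable lborel {0..u} (\<lambda>t. 1 - cdf G t)"
      by (rule set_integrable_subset[OF tail_set_integrable]) auto
    then have int: "integrable lborel (\<lambda>t. indicator {0..u} t *\<^sub>R (1 - cdf G t))"
      by (simp add: set_integrable_def)
    have "ennreal (cdf D u) = emeasure D {..u}"
      by (simp add: cdf_def D.emeasure_eq_measure)
    also have "\<dots> = (\<integral>\<^sup>+t. ennreal (inverse (dist_mean G)) * ennreal (indicator {0..u} t *\<^sub>R (1 - cdf G t)) \<partial>lborel)"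
      unfolding D_def density_eq by (subst emeasure_density) (auto simp: indicator_def intro!: nn_integral_cong)
    also have "\<dots> = ennreal (inverse (dist_mean G)) * ennreal (LBINT t:{0..u}. 1 - cdf G t)"
      unfolding set_lebesgue_integral_def
      by (subst nn_integral_cmult, simp, subst nn_integral_eq_integral[OF int])
        (auto simp: cdf_bounded_prob)
    also have "\<dots> = ennreal ((LBINT t:{0..u}. 1 - cdf G t) / dist_mean G)"
      using mean_pos by (simp add: ennreal_mult'[symmetric] divide_inverse mult.commute)
    finally show ?thesis
      using mean_pos
      by (subst (asm) ennreal_inj)
        (auto simp: D.cdf_nonneg set_lebesgue_integral_def cdf_bounded_prob
          intro!: divide_nonneg_pos Bochner_Integration.integral_nonneg)
  qed
  then have "(\<lambda>u. (LBINT t:{0..u}. 1 - cdf G t) / dist_mean G) = cdf D" by (simp add: fun_eq_iff)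
  then have "integrated_tail G = interval_measure (cdf D)" by (simp add: integrated_tail_def)
  also have "\<dots> = D" by (rule interval_measure_cdf) (rule D.real_distribution_axioms)
  finally have *: "integrated_tail G = D" .
  then show "integrated_tail G = density lborel (\<lambda>t. ennreal ((1 - cdf G t) / dist_mean G) * indicator {0..} t)"
    by (simp add: D_def)
  show "real_distribution (integrated_tail G)"
    unfolding * by (rule D.real_distribution_axioms)
qed

lemma nn_integral_integrated_tail:
  assumes [measurable]: "f \<in> borel_measurable borel"
  shows "(\<integral>\<^sup>+x. f x \<partial>integrated_tail G)
    = (\<integral>\<^sup>+t. ennreal ((1 - cdf G t) / dist_mean G) * indicator {0..} t * f t \<partial>lborel)"
  unfolding integrated_tail_eq_density by (rule nn_integral_density) auto

end

lemma (in positive_mixing) dist_mean_pos: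
  assumes "integrable Q (\<lambda>s. s)"
  shows "0 < dist_mean Q"
  unfolding dist_mean_def using assms pos by (rule expectation_greater[where a = 0])

lemma (in positive_mixing) moment_distribution_mixing:
  assumes int: "integrable Q (\<lambda>s. s)"
  shows "positive_mixing (moment_distribution Q)"
proof -
  note m = dist_mean_pos[OF int]
  have "(\<integral>\<^sup>+s. ennreal (s / dist_mean Q) \<partial>Q) = ennreal (\<integral>s. s / dist_mean Q \<partial>Q)"
    using pos m by (intro nn_integral_eq_integral) (auto simp: int elim!: eventually_mono)
  also have "(\<integral>s. s / dist_mean Q \<partial>Q) = 1"
    using m by (simp add: dist_mean_def)
  finally have *: "(\<integral>\<^sup>+s. ennreal (s / dist_mean Q) \<partial>Q) = 1" by simp
  interpret M: prob_space "moment_distribution Q"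
    by standard (use * in \<open>simp add: moment_distribution_def emeasure_density cong: nn_integral_cong\<close>)
  show ?thesis
  proof
    show "(\<lambda>s. s) \<in> borel_measurable (moment_distribution Q)"
      unfolding moment_distribution_def by simp
    show "AE s in moment_distribution Q. 0 < s"
      unfolding moment_distribution_def by (subst AE_density) (use pos in \<open>auto elim!: eventually_mono\<close>)
  qed
qed

text \<open>Substituting \<open>t = v / s\<close> in the integrated tail of \<open>G\<close>
  produces a factor \<open>1 / s\<close>, which the size-biasing weight \<open>s\<close> of the
  moment distribution cancels. By Tonelli there remains the average of
  \<open>1 - cdf G (v / s)\<close> over \<open>Q\<close>, the tail of the mixture.\<close>

lemma (in positive_mixing) scale_mixture_integrated_tail:
  assumes int: "integrable Q (\<lambda>s. s)" and G: "nonneg_distribution G"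
    and F: "nonneg_distribution (scale_mixture Q G)"
  shows "scale_mixture (moment_distribution Q) (integrated_tail G) = integrated_tail (scale_mixture Q G)"
proof -
  interpret G: nonneg_distribution G by fact
  interpret F: nonneg_distribution "scale_mixture Q G" by fact
  interpret T: real_distribution "integrated_tail G" by (rule G.real_distribution_integrated_tail)
  interpret M: positive_mixing "moment_distribution Q" by (rule moment_distribution_mixing) fact
  interpret H: real_distribution "scale_mixture (moment_distribution Q) (integrated_tail G)"
    by (rule M.real_distribution_scale_mixture) (rule T.real_distribution_axioms)
  interpret FT: real_distribution "integrated_tail (scale_mixture Q G)"
    by (rule F.real_distribution_integrated_tail)
  interpret P: pair_sigma_finite Q lborel ..
  define \<mu> where "\<mu> = dist_mean Q * dist_mean G"
  have \<mu>: "dist_mean (scale_mixture Q G) = \<mu>"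
    unfolding \<mu>_def by (rule dist_mean_scale_mixture[OF G.real_distribution_axioms int G.integrable_id])
  have "0 < dist_mean Q" by (rule dist_mean_pos) fact
  then have "0 < \<mu>" using G.mean_pos by (simp add: \<mu>_def)
  have "cdf (scale_mixture (moment_distribution Q) (integrated_tail G)) u
      = cdf (integrated_tail (scale_mixture Q G)) u" for u
  proof -
    have scale: "ennreal (s / dist_mean Q) * ennreal (cdf (integrated_tail G) (u / s))
        = (\<integral>\<^sup>+v. ennreal ((1 - cdf G (v / s)) / \<mu>) * indicator {0..u} v \<partial>lborel)" if "0 < s" for s
    proof -
      have "ennreal (cdf (integrated_tail G) (u / s)) = (\<integral>\<^sup>+x. indicator {..u / s} x \<partial>integrated_tail G)"
        by (simp add: cdf_def T.emeasure_eq_measure)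
      also have "\<dots> = (\<integral>\<^sup>+t. ennreal ((1 - cdf G t) / dist_mean G) * indicator {0..u / s} t \<partial>lborel)"
        by (subst G.nn_integral_integrated_tail) (auto simp: indicator_def intro!: nn_integral_cong)
      also have "\<dots> = ennreal (1 / s) * (\<integral>\<^sup>+v. ennreal ((1 - cdf G (v / s)) / dist_mean G) * indicator {0..u} v \<partial>lborel)"
        using that by (subst nn_integral_real_affine[where c = "1 / s" and t = 0])
          (auto simp: indicator_def field_simps intro!: arg_cong2[where f = "(*)"] nn_integral_cong)
      finally have "ennreal (s / dist_mean Q) * ennreal (cdf (integrated_tail G) (u / s))
          = ennreal (1 / dist_mean Q) * (\<integral>\<^sup>+v. ennreal ((1 - cdf G (v / s)) / dist_mean G) * indicator {0..u} v \<partial>lborel)"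
        using that \<open>0 < dist_mean Q\<close> by (simp add: mult.assoc[symmetric] ennreal_mult'[symmetric])
      also have "\<dots> = (\<integral>\<^sup>+v. ennreal ((1 - cdf G (v / s)) / \<mu>) * indicator {0..u} v \<partial>lborel)"
        using \<open>0 < dist_mean Q\<close> G.mean_pos G.cdf_bounded_prob
        by (subst nn_integral_cmult[symmetric])
          (auto simp: mult.assoc[symmetric] ennreal_mult'[symmetric] \<mu>_def intro!: nn_integral_cong)
      finally show ?thesis .
    qed
    have "ennreal (cdf (scale_mixture (moment_distribution Q) (integrated_tail G)) u)
        = (\<integral>\<^sup>+s. ennreal (cdf (integrated_tail G) (u / s)) \<partial>moment_distribution Q)"
      unfolding M.cdf_scale_mixture[OF T.real_distribution_axioms]
      using M.id_measurable borel_measurable_cdf[OF T.real_distribution_axioms]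
      by (intro nn_integral_eq_integral[symmetric] M.integrable_const_bound[where B = 1])
        (auto simp: T.cdf_nonneg T.cdf_bounded_prob)
    also have "\<dots> = (\<integral>\<^sup>+s. ennreal (s / dist_mean Q) * ennreal (cdf (integrated_tail G) (u / s)) \<partial>Q)"
      unfolding moment_distribution_def
      using borel_measurable_cdf[OF T.real_distribution_axioms]
      by (intro nn_integral_density) auto
    also have "\<dots> = (\<integral>\<^sup>+s. \<integral>\<^sup>+v. ennreal ((1 - cdf G (v / s)) / \<mu>) * indicator {0..u} v \<partial>lborel \<partial>Q)"
      using pos by (intro nn_integral_cong_AE) (auto simp: scale elim!: eventually_mono)
    also have "\<dots> = (\<integral>\<^sup>+v. \<integral>\<^sup>+s. ennreal ((1 - cdf G (v / s)) / \<mu>) * indicator {0..u} v \<partial>Q \<partial>lborel)"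
      by (rule P.Fubini'[symmetric]) measurable
    also have "\<dots> = (\<integral>\<^sup>+v. ennreal ((1 - cdf (scale_mixture Q G) v) / \<mu>) * indicator {0..u} v \<partial>lborel)"
    proof (intro nn_integral_cong)
      fix v
      have int_cdf: "integrable Q (\<lambda>s. cdf G (v / s))"
        by (intro integrable_const_bound[where B = 1]) (auto simp: G.cdf_nonneg G.cdf_bounded_prob)
      have "(\<integral>\<^sup>+s. ennreal ((1 - cdf G (v / s)) / \<mu>) \<partial>Q) = ennreal (\<integral>s. (1 - cdf G (v / s)) / \<mu> \<partial>Q)"
        using \<open>0 < \<mu>\<close> int_cdf by (intro nn_integral_eq_integral) (auto simp: G.cdf_bounded_prob)
      also have "(\<integral>s. (1 - cdf G (v / s)) / \<mu> \<partial>Q) = (1 - cdf (scale_mixture Q G) v) / \<mu>"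
        using int_cdf by (simp add: cdf_scale_mixture[OF G.real_distribution_axioms] prob_space)
      finally show "(\<integral>\<^sup>+s. ennreal ((1 - cdf G (v / s)) / \<mu>) * indicator {0..u} v \<partial>Q)
          = ennreal ((1 - cdf (scale_mixture Q G) v) / \<mu>) * indicator {0..u} v"
        by (subst nn_integral_multc) auto
    qed
    also have "\<dots> = (\<integral>\<^sup>+x. indicator {..u} x \<partial>integrated_tail (scale_mixture Q G))"
      by (subst F.nn_integral_integrated_tail) (auto simp: \<mu> indicator_def intro!: nn_integral_cong)
    also have "\<dots> = ennreal (cdf (integrated_tail (scale_mixture Q G)) u)"
      by (simp add: cdf_def FT.emeasure_eq_measure)
    finally show ?thesis by (simp add: H.cdf_nonneg FT.cdf_nonneg)
  qed
  then show ?thesis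
    by (intro cdf_unique H.real_distribution_axioms FT.real_distribution_axioms) (simp add: fun_eq_iff)
qed

section \<open>The random walk of net losses\<close>

lemma nn_integral_Icc_eq_set_integral:
  fixes g :: "real \<Rightarrow> real"
  assumes [measurable]: "g \<in> borel_measurable borel"
    and g: "\<And>y. 0 \<le> y \<Longrightarrow> y \<le> u \<Longrightarrow> 0 \<le> g y \<and> g y \<le> B"
  shows "set_integrable lborel {0..u} g"
    and "(\<integral>\<^sup>+y. ennreal (g y) * indicator {0..u} y \<partial>lborel) = ennreal (LBINT y:{0..u}. g y)"
proof -
  show int: "set_integrable lborel {0..u} g"
    unfolding set_integrable_def
  proof (rule Bochner_Integration.integrable_bound)
    show "integrable lborel (\<lambda>y. indicator {0..u} y *\<^sub>R B)"
      by (intro integrable_scaleR_left integrable_real_indicator) (auto simp: emeasure_lborel_Icc_eq)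
    show "AE y in lborel. norm (indicator {0..u} y *\<^sub>R g y) \<le> norm (indicator {0..u} y *\<^sub>R B)"
      using g by (intro AE_I2) (force simp: indicator_def)
  qed measurable
  have "(\<integral>\<^sup>+y. ennreal (g y) * indicator {0..u} y \<partial>lborel)
      = (\<integral>\<^sup>+y. ennreal (indicator {0..u} y *\<^sub>R g y) \<partial>lborel)"
    by (intro nn_integral_cong) (auto simp: indicator_def)
  also have "\<dots> = ennreal (LBINT y:{0..u}. g y)"
    unfolding set_lebesgue_integral_def
    using int g by (intro nn_integral_eq_integral) (auto simp: set_integrable_def indicator_def)
  finally show "(\<integral>\<^sup>+y. ennreal (g y) * indicator {0..u} y \<partial>lborel) = ennreal (LBINT y:{0..u}. g y)" .
qed

context cramer_lundberg
begin

definition net_loss :: "nat \<Rightarrow> 'a \<Rightarrow> real" where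
  "net_loss k \<omega> = X k \<omega> - W k \<omega>"

text \<open>The start index \<open>m\<close> allows passing to the walk after its first step. The
  empty sum at \<open>k = 0\<close> is included, so the event is empty for
  \<open>u < 0\<close>.\<close>

definition stays_below :: "nat \<Rightarrow> nat \<Rightarrow> real \<Rightarrow> 'a set" where
  "stays_below m n u = {\<omega> \<in> space M. \<forall>k\<le>n. (\<Sum>i<k. net_loss (m + i) \<omega>) \<le> u}"

lemma measurable_W [measurable]: "W k \<in> borel_measurable M"
  and measurable_X [measurable]: "X k \<in> borel_measurable M"
proof -
  have "random_variable borel (case_sum W X i)" for i
    using indep_W_X by (simp add: indep_vars_def)
  from this[of "Inl k"] this[of "Inr k"] show "W k \<in> borel_measurable M" "X k \<in> borel_measurable M"
    by simp_all
qed

lemma measurable_net_loss [measurable]: "net_loss k \<in> borel_measurable M"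
  unfolding net_loss_def[abs_def] by measurable

lemma stays_below_events [measurable]: "stays_below m n u \<in> events"
  unfolding stays_below_def by measurable

text \<open>Each net loss reads only the coordinates \<open>Inl k\<close> and \<open>Inr k\<close>,
  and these pairs are disjoint for different \<open>k\<close>.\<close>

lemma indep_net_loss: "indep_vars (\<lambda>_. borel) net_loss UNIV"
proof -
  have "indep_vars (\<lambda>_. borel) (\<lambda>k \<omega>. (\<lambda>f. f (Inr k) - f (Inl k))
      (restrict (\<lambda>i. case_sum W X i \<omega>) {Inl k, Inr k})) UNIV"
    by (rule indep_vars_compose2[OF indep_vars_restrict[OF indep_W_X]])
      (auto simp: disjoint_family_on_def)
  then show ?thesis by (simp add: net_loss_def[abs_def])
qed

text \<open>The right-hand side does not mention \<open>k\<close>: here the identical distribution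
  of the steps enters.\<close>

lemma nn_integral_net_loss:
  assumes [measurable]: "f \<in> borel_measurable borel"
  shows "(\<integral>\<^sup>+\<omega>. f (net_loss k \<omega>) \<partial>M)
    = (\<integral>\<^sup>+w. ennreal (exponential_density intensity w) * (\<integral>\<^sup>+x. f (x - w) \<partial>F) \<partial>lborel)"
proof -
  have "indep_var borel ((\<lambda>f. f (Inl k)) \<circ> (\<lambda>\<omega>. restrict (\<lambda>i. case_sum W X i \<omega>) {Inl k}))
      borel ((\<lambda>f. f (Inr k)) \<circ> (\<lambda>\<omega>. restrict (\<lambda>i. case_sum W X i \<omega>) {Inr k}))"
    by (rule indep_var_compose[OF indep_var_restrict[OF indep_W_X]]) auto
  then have "indep_var borel (W k) borel (X k)" by (simp add: comp_def)
  then have joint: "distr M borel (W k) \<Otimes>\<^sub>M distr M borel (X k)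
      = distr M (borel \<Otimes>\<^sub>M borel) (\<lambda>\<omega>. (W k \<omega>, X k \<omega>))"
    by (simp add: indep_var_distribution_eq)
  interpret DX: prob_space "distr M borel (X k)" by (rule prob_space_distr) simp
  have "(\<integral>\<^sup>+\<omega>. f (net_loss k \<omega>) \<partial>M)
      = (\<integral>\<^sup>+z. f (snd z - fst z) \<partial>distr M (borel \<Otimes>\<^sub>M borel) (\<lambda>\<omega>. (W k \<omega>, X k \<omega>)))"
    by (subst nn_integral_distr) (auto simp: net_loss_def)
  also have "\<dots> = (\<integral>\<^sup>+w. \<integral>\<^sup>+x. f (x - w) \<partial>distr M borel (X k) \<partial>distr M borel (W k))"
    unfolding joint[symmetric] by (subst DX.nn_integral_fst[symmetric]) auto
  also have "\<dots> = (\<integral>\<^sup>+w. (\<integral>\<^sup>+x. f (x - w) \<partial>F) \<partial>distr M lborel (W k))"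
    unfolding claim_dist by (intro nn_integral_cong_simp arg_cong2[where f = nn_integral] distr_cong) auto
  also have "\<dots> = (\<integral>\<^sup>+w. ennreal (exponential_density intensity w) * (\<integral>\<^sup>+x. f (x - w) \<partial>F) \<partial>lborel)"
  proof -
    have "(\<lambda>w. \<integral>\<^sup>+x. f (x - w) \<partial>F) \<in> borel_measurable borel"
      unfolding claim_dist[of k, symmetric] by (rule DX.borel_measurable_nn_integral) measurable
    then show ?thesis
      unfolding distributed_distr_eq_density[OF interarrival_dist]
      by (intro nn_integral_density) auto
  qed
  finally show ?thesis .
qed

text \<open>First-step decomposition: step \<open>m\<close> and the block of all later steps are
  independent, so the event is measured by Tonelli on the product of their laws. The indicator is
  the constraint at \<open>k = 0\<close>.\<close>

lemma emeasure_stays_below_Suc: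
  "emeasure M (stays_below m (Suc n) u)
    = indicator {0..} u * (\<integral>\<^sup>+\<omega>. emeasure M (stays_below (Suc m) n (u - net_loss m \<omega>)) \<partial>M)"
proof (cases "0 \<le> u")
  case True
  let ?P = "\<lambda>I. Pi\<^sub>M I (\<lambda>_. borel :: real measure)"
  define R where "R I = (\<lambda>\<omega>. restrict (\<lambda>i. net_loss i \<omega>) I)" for I
  define E where "E = {z \<in> space (?P {m} \<Otimes>\<^sub>M ?P {Suc m..}).
      \<forall>k\<le>n. fst z m + (\<Sum>i<k. snd z (Suc m + i)) \<le> u}"
  have [measurable]: "E \<in> sets (?P {m} \<Otimes>\<^sub>M ?P {Suc m..})" unfolding E_def by measurable
  have [measurable]: "R I \<in> measurable M (?P I)" for I unfolding R_def by measurable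
  have "indep_var (?P {m}) (R {m}) (?P {Suc m..}) (R {Suc m..})"
    unfolding R_def by (rule indep_var_restrict[OF indep_net_loss]) auto
  then have joint: "distr M (?P {m}) (R {m}) \<Otimes>\<^sub>M distr M (?P {Suc m..}) (R {Suc m..})
      = distr M (?P {m} \<Otimes>\<^sub>M ?P {Suc m..}) (\<lambda>\<omega>. (R {m} \<omega>, R {Suc m..} \<omega>))"
    by (simp add: indep_var_distribution_eq)
  interpret DR: prob_space "distr M (?P {Suc m..}) (R {Suc m..})" by (rule prob_space_distr) simp
  have "(\<forall>k\<le>Suc n. (\<Sum>i<k. net_loss (m + i) \<omega>) \<le> u)
      \<longleftrightarrow> (\<forall>k\<le>n. net_loss m \<omega> + (\<Sum>i<k. net_loss (Suc m + i) \<omega>) \<le> u)" for \<omega>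
  proof -
    have "(\<forall>k\<le>Suc n. Q k) \<longleftrightarrow> Q 0 \<and> (\<forall>k\<le>n. Q (Suc k))" for Q :: "nat \<Rightarrow> bool"
      by (metis Suc_le_mono not0_implies_Suc zero_le)
    then show ?thesis using True by (simp add: sum.lessThan_Suc_shift del: sum.lessThan_Suc)
  qed
  then have "stays_below m (Suc n) u = (\<lambda>\<omega>. (R {m} \<omega>, R {Suc m..} \<omega>)) -` E \<inter> space M"
    by (auto simp: stays_below_def E_def R_def space_pair_measure space_PiM)
  then have "emeasure M (stays_below m (Suc n) u)
      = emeasure (distr M (?P {m}) (R {m}) \<Otimes>\<^sub>M distr M (?P {Suc m..}) (R {Suc m..})) E"
    unfolding joint by (simp add: emeasure_distr)
  also have "\<dots> = (\<integral>\<^sup>+z. emeasure (distr M (?P {Suc m..}) (R {Suc m..})) (Pair z -` E) \<partial>distr M (?P {m}) (R {m}))"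
    by (rule DR.emeasure_pair_measure_alt) simp
  also have "\<dots> = (\<integral>\<^sup>+\<omega>. emeasure (distr M (?P {Suc m..}) (R {Suc m..})) (Pair (R {m} \<omega>) -` E) \<partial>M)"
    by (rule nn_integral_distr) (auto intro!: DR.measurable_emeasure_Pair)
  also have "\<dots> = (\<integral>\<^sup>+\<omega>. emeasure M (stays_below (Suc m) n (u - net_loss m \<omega>)) \<partial>M)"
  proof (intro nn_integral_cong)
    fix \<omega> assume "\<omega> \<in> space M"
    have "R {Suc m..} -` (Pair (R {m} \<omega>) -` E) \<inter> space M = stays_below (Suc m) n (u - net_loss m \<omega>)"
      by (auto simp: stays_below_def E_def R_def space_pair_measure space_PiM algebra_simps)
    then show "emeasure (distr M (?P {Suc m..}) (R {Suc m..})) (Pair (R {m} \<omega>) -` E)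
        = emeasure M (stays_below (Suc m) n (u - net_loss m \<omega>))"
      by (subst emeasure_distr) (auto intro!: sets_Pair1)
  qed
  finally show ?thesis using True by simp
next
  case False
  then have "stays_below m (Suc n) u = {}" by (force simp: stays_below_def)
  then show ?thesis using False by simp
qed

definition surv :: "nat \<Rightarrow> real \<Rightarrow> real" where
  "surv n u = prob (stays_below 0 n u)"

lemma mono_surv: "mono (surv n)"
  unfolding surv_def stays_below_def by (intro monoI finite_measure_mono) (auto intro: order_trans)

lemma measurable_surv [measurable]: "surv n \<in> borel_measurable borel"
  by (rule borel_measurable_mono) (rule mono_surv)

lemma surv_nonneg: "0 \<le> surv n u" and surv_le_1: "surv n u \<le> 1"
  by (simp_all add: surv_def)

lemma surv_eq_0: "u < 0 \<Longrightarrow> surv n u = 0"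
proof -
  assume "u < 0"
  then have "stays_below 0 n u = {}" by (force simp: stays_below_def)
  then show ?thesis by (simp add: surv_def)
qed

text \<open>Stationarity of the walk: the recursion has the same right-hand side for every start
  index, since the one-step law does not depend on \<open>m\<close>.\<close>

lemma emeasure_stays_below: "emeasure M (stays_below m n u) = ennreal (surv n u)"
proof (induction n arbitrary: m u)
  case 0
  have "stays_below m 0 u = stays_below 0 0 u" by (simp add: stays_below_def)
  then show ?case by (simp add: surv_def emeasure_eq_measure)
next
  case (Suc n)
  have "emeasure M (stays_below m (Suc n) u) = emeasure M (stays_below 0 (Suc n) u)"
    unfolding emeasure_stays_below_Suc Suc.IH
    by (simp add: nn_integral_net_loss[where f = "\<lambda>z. ennreal (surv n (u - z))"])
  then show ?case by (simp add: surv_def emeasure_eq_measure)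
qed

lemma surv_Suc:
  assumes "0 \<le> u"
  shows "ennreal (surv (Suc n) u) = (\<integral>\<^sup>+w. ennreal (exponential_density intensity w)
    * (\<integral>\<^sup>+x. ennreal (surv n (u + w - x)) \<partial>F) \<partial>lborel)"
  using assms emeasure_stays_below_Suc[of 0 n u]
  by (simp add: emeasure_stays_below nn_integral_net_loss[where f = "\<lambda>z. ennreal (surv n (u - z))"]
      algebra_simps)

lemma surv_Suc_le: "surv (Suc n) u \<le> surv n u"
  unfolding surv_def by (intro finite_measure_mono) (auto simp: stays_below_def)

text \<open>At a fixed horizon only finitely many partial sums matter, and their maximum is finite
  for each outcome.\<close>

lemma surv_tendsto_1: "(\<lambda>j. surv n (real j)) \<longlonglongrightarrow> 1"
proof -
  have "(\<lambda>j. surv n (real j)) \<longlonglongrightarrow> prob (\<Union>j. stays_below 0 n (real j))"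
    unfolding surv_def
    by (rule finite_Lim_measure_incseq) (auto simp: incseq_def stays_below_def intro: order_trans)
  also have "(\<Union>j. stays_below 0 n (real j)) = space M"
  proof -
    have "\<exists>j. \<forall>k\<le>n. (\<Sum>i<k. net_loss i \<omega>) \<le> real j" for \<omega>
    proof -
      obtain j where "Max ((\<lambda>k. \<Sum>i<k. net_loss i \<omega>) ` {..n}) \<le> real j"
        using real_arch_simple by blast
      then show ?thesis by (intro exI[of _ j]) simp
    qed
    then show ?thesis by (auto simp: stays_below_def)
  qed
  finally show ?thesis by (simp add: prob_space)
qed

definition survival :: "real \<Rightarrow> real" where
  "survival u = prob {\<omega> \<in> space M. \<forall>n. (\<Sum>i<n. net_loss i \<omega>) \<le> u}"

lemma surv_tendsto_survival: "(\<lambda>n. surv n u) \<longlonglongrightarrow> survival u"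
proof -
  have "(\<lambda>n. surv n u) \<longlonglongrightarrow> prob (\<Inter>n. stays_below 0 n u)"
    unfolding surv_def
    by (rule finite_Lim_measure_decseq) (auto simp: decseq_def stays_below_def)
  also have "(\<Inter>n. stays_below 0 n u) = {\<omega> \<in> space M. \<forall>n. (\<Sum>i<n. net_loss i \<omega>) \<le> u}"
    by (auto simp: stays_below_def)
  finally show ?thesis by (simp add: survival_def)
qed

lemma survival_nonneg: "0 \<le> survival u" and survival_le_1: "survival u \<le> 1"
  by (simp_all add: survival_def)

lemma measurable_survival [measurable]: "survival \<in> borel_measurable borel"
  by (intro borel_measurable_mono monoI)
    (auto simp: survival_def intro!: finite_measure_mono intro: order_trans)

section \<open>From the ruin event in continuous time to the random walk\<close>

lemma claim_number_at_arrival: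
  assumes W: "\<And>k. 0 < W k \<omega>" and n: "1 \<le> n"
  shows "claim_number W (\<Sum>k<n. W k \<omega>) \<omega> = n"
proof -
  have "strict_mono (\<lambda>n. \<Sum>k<n. W k \<omega>)"
    using W by (intro strict_mono_Suc_iff[THEN iffD2]) simp
  then have "{m. 1 \<le> m \<and> (\<Sum>k<m. W k \<omega>) \<le> (\<Sum>k<n. W k \<omega>)} = {1..n}"
    using strict_mono_less_eq[of "\<lambda>n. \<Sum>k<n. W k \<omega>"] by auto
  then show ?thesis by (simp add: claim_number_def)
qed

text \<open>Between claims the reserve only grows, so ruin is visible at an arrival time, where the
  reserve is \<open>u\<close> minus a partial sum of net losses.\<close>

lemma ruin_iff_net_loss:
  assumes W: "\<And>k. 0 < W k \<omega>" and u: "0 \<le> u"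
  shows "(\<exists>t>0. reserve W X u t \<omega> < 0) \<longleftrightarrow> (\<exists>n. u < (\<Sum>i<n. net_loss i \<omega>))"
proof
  assume "\<exists>t>0. reserve W X u t \<omega> < 0"
  then obtain t where t: "0 < t" "reserve W X u t \<omega> < 0" by blast
  define N where "N = claim_number W t \<omega>"
  \<comment> \<open>A zero count would leave the reserve \<open>u + t > 0\<close>. This also
    excludes infinitely many arrivals up to \<open>t\<close>, for which \<open>card\<close> returns
    0.\<close>
  have "N \<noteq> 0" using t u by (cases "N = 0") (auto simp: reserve_def N_def[symmetric])
  have mono: "strict_mono (\<lambda>n. \<Sum>k<n. W k \<omega>)"
    using W by (intro strict_mono_Suc_iff[THEN iffD2]) simp
  \<comment> \<open>The \<open>N\<close> positive indices with arrival by \<open>t\<close> cannot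
    all lie below \<open>N\<close>; monotonicity then brings the bound from \<open>n\<close> down to
    \<open>N\<close>.\<close>
  have "\<exists>n. N \<le> n \<and> (\<Sum>k<n. W k \<omega>) \<le> t"
  proof (rule ccontr)
    assume *: "\<not> ?thesis"
    then have "{n. 1 \<le> n \<and> (\<Sum>k<n. W k \<omega>) \<le> t} \<subseteq> {1..<N}"
      by (force simp: not_le)
    from card_mono[OF _ this] \<open>N \<noteq> 0\<close> show False
      by (simp add: N_def claim_number_def)
  qed
  then obtain n where "N \<le> n" "(\<Sum>k<n. W k \<omega>) \<le> t" by blast
  then have "(\<Sum>k<N. W k \<omega>) \<le> t"
    using strict_mono_less_eq[OF mono, of N n] by simp
  then have "u < (\<Sum>i<N. net_loss i \<omega>)"
    using t by (simp add: reserve_def net_loss_def N_def[symmetric] sum_subtractf)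
  then show "\<exists>n. u < (\<Sum>i<n. net_loss i \<omega>)" ..
next
  assume "\<exists>n. u < (\<Sum>i<n. net_loss i \<omega>)"
  then obtain n where n: "u < (\<Sum>i<n. net_loss i \<omega>)" ..
  then have "n \<noteq> 0" using u by (cases n) auto
  then have "0 < (\<Sum>k<n. W k \<omega>)" using W by (intro sum_pos) auto
  moreover have "reserve W X u (\<Sum>k<n. W k \<omega>) \<omega> < 0"
    using n claim_number_at_arrival[OF W] \<open>n \<noteq> 0\<close> by (simp add: reserve_def net_loss_def sum_subtractf)
  ultimately show "\<exists>t>0. reserve W X u t \<omega> < 0" by blast
qed

text \<open>Reduces the uncountable union over \<open>t\<close> to a countable one, for measurability. Between arrivals the
  reserve increases, so only arrival times matter; rational times are needed in addition on the
  null event where some \<open>W k\<close> is negative.\<close>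

lemma ruin_event_countable:
  assumes u: "0 \<le> u"
  shows "(\<exists>t>0. reserve W X u t \<omega> < 0) \<longleftrightarrow>
    (\<exists>n. 0 < (\<Sum>k<n. W k \<omega>) \<and> reserve W X u (\<Sum>k<n. W k \<omega>) \<omega> < 0) \<or>
    (\<exists>q::rat. 0 < q \<and> reserve W X u (of_rat q) \<omega> < 0)" (is "?L \<longleftrightarrow> ?R1 \<or> ?R2")
proof
  assume ?L
  then obtain t where t: "0 < t" "reserve W X u t \<omega> < 0" by blast
  define A where "A t = {n. 1 \<le> n \<and> (\<Sum>k<n. W k \<omega>) \<le> t}" for t
  have card: "claim_number W t \<omega> = card (A t)" for t by (simp add: claim_number_def A_def)
  have "claim_number W t \<omega> \<noteq> 0"
    using t u by (cases "claim_number W t \<omega> = 0") (auto simp: reserve_def)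
  then have fin: "finite (A t)" and "A t \<noteq> {}" by (auto simp: card intro: card_ge_0_finite)
  then have "Max ((\<lambda>n. \<Sum>k<n. W k \<omega>) ` A t) \<in> (\<lambda>n. \<Sum>k<n. W k \<omega>) ` A t"
    by (intro Max_in) auto
  then obtain n where n: "n \<in> A t" "Max ((\<lambda>n. \<Sum>k<n. W k \<omega>) ` A t) = (\<Sum>k<n. W k \<omega>)" by blast
  let ?T = "\<Sum>k<n. W k \<omega>"
  have "?T \<le> t" using n(1) by (simp add: A_def)
  have le_T: "(\<Sum>k<m. W k \<omega>) \<le> ?T" if "m \<in> A t" for m
    unfolding n(2)[symmetric] using that fin by simp
  \<comment> \<open>\<open>?T\<close> is the latest arrival time not exceeding \<open>t\<close>, so
    the claims counted are the same on all of \<open>{?T..t}\<close>, and going back in time only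
    lowers the premium income.\<close>
  have same: "A r = A t" if "?T \<le> r" "r \<le> t" for r
    using le_T that by (auto simp: A_def intro: order_trans)
  have neg: "reserve W X u r \<omega> < 0" if "?T \<le> r" "r \<le> t" for r
    using t(2) that by (simp add: reserve_def card same[OF that])
  show "?R1 \<or> ?R2"
  proof (cases "0 < ?T")
    case True
    then show ?thesis using neg[of ?T] \<open>?T \<le> t\<close> by blast
  next
    case False
    obtain q where "0 < real_of_rat q" "real_of_rat q < t" using of_rat_dense[OF t(1)] by blast
    moreover have "?T \<le> real_of_rat q" using False calculation(1) by linarith
    ultimately show ?thesis using neg[of "real_of_rat q"] by (intro disjI2 exI[of _ q]) auto
  qed
next
  assume "?R1 \<or> ?R2"
  then show ?L
  proof
    assume ?R2
    then obtain q where "0 < q" "reserve W X u (of_rat q) \<omega> < 0" by blast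
    then show ?L by (intro exI[of _ "of_rat q"]) simp
  qed blast
qed

text \<open>\<open>measure\<close> is 0 on nonmeasurable sets, so this makes
  \<open>ruin_prob\<close> a genuine probability. The claim number at a random time has countably
  many values, hence the reserve there is measurable.\<close>

lemma ruin_event_measurable:
  assumes "0 \<le> u"
  shows "{\<omega> \<in> space M. \<exists>t>0. reserve W X u t \<omega> < 0} \<in> events"
proof -
  have [measurable]: "(\<lambda>\<omega>. reserve W X u (T \<omega>) \<omega>) \<in> borel_measurable M"
    if [measurable]: "T \<in> borel_measurable M" for T
  proof -
    have [measurable]: "(\<lambda>\<omega>. claim_number W (T \<omega>) \<omega>) \<in> measurable M (count_space UNIV)"
      unfolding claim_number_def by (rule measurable_card) measurable
    have "(\<lambda>\<omega>. \<Sum>k<claim_number W (T \<omega>) \<omega>. X k \<omega>) \<in> borel_measurable M"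
      by (rule measurable_compose_countable[where f = "\<lambda>n \<omega>. \<Sum>k<n. X k \<omega>"]) measurable
    then show ?thesis unfolding reserve_def by measurable
  qed
  show ?thesis unfolding ruin_event_countable[OF assms] by measurable
qed

lemma AE_interarrival_pos: "AE \<omega> in M. \<forall>k. 0 < W k \<omega>"
proof (rule AE_all_countable[THEN iffD2], rule)
  fix k
  have "prob {\<omega> \<in> space M. 0 < W k \<omega>} = 1"
    using exponential_distributedD_gt[OF interarrival_dist order_refl intensity_pos] by simp
  then show "AE \<omega> in M. 0 < W k \<omega>"
    by (subst (asm) prob_Collect_eq_1) auto
qed

lemma ruin_prob_eq_survival:
  assumes "0 \<le> u"
  shows "ruin_prob M W X u = 1 - survival u"
proof -
  have "prob {\<omega> \<in> space M. \<exists>t>0. reserve W X u t \<omega> < 0}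
      = prob {\<omega> \<in> space M. \<exists>n. u < (\<Sum>i<n. net_loss i \<omega>)}"
  proof (rule finite_measure_eq_AE)
    show "AE \<omega> in M. (\<omega> \<in> {\<omega> \<in> space M. \<exists>t>0. reserve W X u t \<omega> < 0})
        = (\<omega> \<in> {\<omega> \<in> space M. \<exists>n. u < (\<Sum>i<n. net_loss i \<omega>)})"
      using AE_interarrival_pos by eventually_elim (use assms ruin_iff_net_loss in auto)
    show "{\<omega> \<in> space M. \<exists>t>0. reserve W X u t \<omega> < 0} \<in> events"
      by (rule ruin_event_measurable) fact
  qed measurable
  also have "{\<omega> \<in> space M. \<exists>n. u < (\<Sum>i<n. net_loss i \<omega>)}
      = space M - {\<omega> \<in> space M. \<forall>n. (\<Sum>i<n. net_loss i \<omega>) \<le> u}"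
    by (auto simp: not_le[symmetric])
  also have "prob \<dots> = 1 - survival u"
    unfolding survival_def by (rule prob_compl) measurable
  finally show ?thesis by (simp add: ruin_prob_def)
qed

end

section \<open>The renewal equation for the survival probability\<close>

text \<open>Integrated form of \<open>A' = l (A - h)\<close>, which needs no continuity of \<open>h\<close>; stated additively so that it
  can be proved in \<open>ennreal\<close> by Tonelli alone.\<close>

lemma exponential_average_identity:
  fixes h :: "real \<Rightarrow> ennreal"
  assumes [measurable]: "h \<in> borel_measurable borel" and l: "0 < l" and u: "0 \<le> u"
  defines "A \<equiv> \<lambda>v. \<integral>\<^sup>+w. ennreal (exponential_density l w) * h (v + w) \<partial>lborel"
  shows "A u + ennreal l * (\<integral>\<^sup>+v. h v * indicator {0..<u} v \<partial>lborel)
       = A 0 + ennreal l * (\<integral>\<^sup>+v. A v * indicator {0..u} v \<partial>lborel)"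
proof -
  have A_shift: "A v = (\<integral>\<^sup>+z. ennreal (exponential_density l (z - v)) * h z \<partial>lborel)" for v
    unfolding A_def by (subst (2) nn_integral_real_affine[where c = 1 and t = v]) auto
  \<comment> \<open>The weight of \<open>h z\<close> on the two sides after Tonelli. The identity is
    exact for every \<open>z\<close>: at \<open>z = u\<close> the exponential density already
    contributes \<open>l\<close>, which is why the indicator of \<open>{0..<u}\<close> is
    half-open.\<close>
  have inner: "ennreal l * (\<integral>\<^sup>+v. ennreal (exponential_density l (z - v)) * indicator {0..u} v \<partial>lborel)
      + ennreal (exponential_density l z)
      = ennreal (exponential_density l (z - u)) + ennreal l * indicator {0..<u} z" for z
  proof (cases "0 \<le> z")
    case True
    have "(\<integral>\<^sup>+v. ennreal (exponential_density l (z - v)) * indicator {0..u} v \<partial>lborel)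
        = (\<integral>\<^sup>+v. ennreal (l * exp (- l * (z - v))) * indicator {0..min u z} v \<partial>lborel)"
      by (intro nn_integral_cong) (auto simp: exponential_density_def indicator_def algebra_simps)
    also have "\<dots> = ennreal (exp (- l * (z - min u z)) - exp (- l * (z - 0)))"
      using True u l
      by (intro nn_integral_FTC_Icc) (auto intro!: derivative_eq_intros simp: algebra_simps)
    finally have "(\<integral>\<^sup>+v. ennreal (exponential_density l (z - v)) * indicator {0..u} v \<partial>lborel)
        = ennreal (exp (- l * (z - min u z)) - exp (- l * z))" by simp
    moreover have "exp (- l * z) \<le> exp (- l * (z - min u z))"
      using True u l by (simp add: mult_le_cancel_left_pos)
    ultimately show ?thesis
      using True u l
      by (auto simp: exponential_density_def ennreal_mult'[symmetric] ennreal_plus[symmetric]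
          min_def indicator_def algebra_simps simp del: ennreal_plus)
  next
    case False
    have "(\<integral>\<^sup>+v. ennreal (exponential_density l (z - v)) * indicator {0..u} v \<partial>lborel)
        = (\<integral>\<^sup>+v. 0 \<partial>(lborel :: real measure))"
      using False by (intro nn_integral_cong) (auto simp: exponential_density_def indicator_def)
    then show ?thesis using False u by (simp add: exponential_density_def)
  qed
  have "(\<integral>\<^sup>+v. A v * indicator {0..u} v \<partial>lborel)
      = (\<integral>\<^sup>+v. \<integral>\<^sup>+z. h z * (ennreal (exponential_density l (z - v)) * indicator {0..u} v) \<partial>lborel \<partial>lborel)"
    unfolding A_shift by (subst nn_integral_multc[symmetric]) (auto simp: mult_ac)
  also have "\<dots> = (\<integral>\<^sup>+z. \<integral>\<^sup>+v. h z * (ennreal (exponential_density l (z - v)) * indicator {0..u} v) \<partial>lborel \<partial>lborel)"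
    by (rule lborel_pair.Fubini') simp
  also have "\<dots> = (\<integral>\<^sup>+z. h z * (\<integral>\<^sup>+v. ennreal (exponential_density l (z - v)) * indicator {0..u} v \<partial>lborel) \<partial>lborel)"
    by (intro nn_integral_cong nn_integral_cmult) simp
  finally have "A 0 + ennreal l * (\<integral>\<^sup>+v. A v * indicator {0..u} v \<partial>lborel)
      = (\<integral>\<^sup>+z. ennreal (exponential_density l z) * h z \<partial>lborel) + (\<integral>\<^sup>+z. ennreal l * (h z *
          (\<integral>\<^sup>+v. ennreal (exponential_density l (z - v)) * indicator {0..u} v \<partial>lborel)) \<partial>lborel)"
    unfolding A_shift[of 0] by (subst nn_integral_cmult) simp_all
  also have "\<dots> = (\<integral>\<^sup>+z. ennreal (exponential_density l z) * h z + ennreal l * (h z *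
          (\<integral>\<^sup>+v. ennreal (exponential_density l (z - v)) * indicator {0..u} v \<partial>lborel)) \<partial>lborel)"
    by (rule nn_integral_add[symmetric]) simp_all
  also have "\<dots> = (\<integral>\<^sup>+z. h z * (ennreal l * (\<integral>\<^sup>+v. ennreal (exponential_density l (z - v)) * indicator {0..u} v \<partial>lborel)
          + ennreal (exponential_density l z)) \<partial>lborel)"
    by (intro nn_integral_cong) (simp add: distrib_left mult.commute mult.left_commute add.commute)
  also have "\<dots> = (\<integral>\<^sup>+z. ennreal (exponential_density l (z - u)) * h z
      + ennreal l * (h z * indicator {0..<u} z) \<partial>lborel)"
    unfolding inner by (intro nn_integral_cong) (simp add: distrib_left mult_ac)
  also have "\<dots> = A u + ennreal l * (\<integral>\<^sup>+v. h v * indicator {0..<u} v \<partial>lborel)"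
    unfolding A_shift[of u] by (simp add: nn_integral_add nn_integral_cmult)
  finally show ?thesis ..
qed

lemma set_integral_reflect_Icc:
  fixes g :: "real \<Rightarrow> real"
  shows "(LBINT y:{0..u}. g (u - y)) = (LBINT y:{0..u}. g y)"
proof -
  have "(LBINT y:{0..u}. g y) = (\<integral>y. indicator {0..u} (u - y) *\<^sub>R g (u - y) \<partial>lborel)"
    unfolding set_lebesgue_integral_def
    using lborel_integral_real_affine[of "-1" "\<lambda>y. indicator {0..u} y *\<^sub>R g y" u] by simp
  also have "\<dots> = (LBINT y:{0..u}. g (u - y))"
    unfolding set_lebesgue_integral_def
    by (intro Bochner_Integration.integral_cong) (auto simp: indicator_def)
  finally show ?thesis ..
qed

text \<open>The shift \<open>v = x + y\<close> and Tonelli leave the mass of those \<open>x\<close>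
  with \<open>x + y\<close> in \<open>{0..u}\<close>; as both variables are nonnegative, this is
  \<open>cdf G (u - y)\<close>. Claims then enter only through their cdf.\<close>

lemma (in nonneg_distribution) nn_integral_convolution_cdf:
  assumes [measurable]: "f \<in> borel_measurable borel" and f: "\<And>y. y < 0 \<Longrightarrow> f y = 0"
  shows "(\<integral>\<^sup>+v. (\<integral>\<^sup>+x. f (v - x) \<partial>G) * indicator {0..u} v \<partial>lborel)
    = (\<integral>\<^sup>+y. f y * ennreal (cdf G (u - y)) * indicator {0..u} y \<partial>lborel)"
proof -
  interpret P: pair_sigma_finite G lborel ..
  have "(\<integral>\<^sup>+v. (\<integral>\<^sup>+x. f (v - x) \<partial>G) * indicator {0..u} v \<partial>lborel)
      = (\<integral>\<^sup>+v. \<integral>\<^sup>+x. f (v - x) * indicator {0..u} v \<partial>G \<partial>lborel)"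
    by (intro nn_integral_cong nn_integral_multc[symmetric]) simp
  also have "\<dots> = (\<integral>\<^sup>+x. \<integral>\<^sup>+v. f (v - x) * indicator {0..u} v \<partial>lborel \<partial>G)"
    by (rule P.Fubini') simp
  also have "\<dots> = (\<integral>\<^sup>+x. \<integral>\<^sup>+y. f y * indicator {0..u} (x + y) \<partial>lborel \<partial>G)"
  proof (rule nn_integral_cong)
    fix x :: real
    show "(\<integral>\<^sup>+v. f (v - x) * indicator {0..u} v \<partial>lborel) = (\<integral>\<^sup>+y. f y * indicator {0..u} (x + y) \<partial>lborel)"
      by (subst nn_integral_real_affine[where c = 1 and t = x]) auto
  qed
  also have "\<dots> = (\<integral>\<^sup>+y. \<integral>\<^sup>+x. f y * indicator {0..u} (x + y) \<partial>G \<partial>lborel)"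
    by (rule P.Fubini'[symmetric]) simp
  also have "\<dots> = (\<integral>\<^sup>+y. f y * ennreal (cdf G (u - y)) * indicator {0..u} y \<partial>lborel)"
  proof (intro nn_integral_cong)
    fix y :: real
    have "(\<integral>\<^sup>+x. f y * indicator {0..u} (x + y) \<partial>G)
        = (\<integral>\<^sup>+x. f y * indicator {0..u} y * indicator {..u - y} x \<partial>G)"
    proof (rule nn_integral_cong_AE)
      show "AE x in G. f y * indicator {0..u} (x + y) = f y * indicator {0..u} y * indicator {..u - y} x"
        using nonneg by eventually_elim (auto simp: indicator_def f)
    qed
    also have "\<dots> = f y * indicator {0..u} y * emeasure G {..u - y}"
      by (subst nn_integral_cmult) auto
    finally show "(\<integral>\<^sup>+x. f y * indicator {0..u} (x + y) \<partial>G)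
        = f y * ennreal (cdf G (u - y)) * indicator {0..u} y"
      by (simp add: cdf_def emeasure_eq_measure mult_ac)
  qed
  finally show ?thesis .
qed

locale finite_mean_cramer_lundberg = cramer_lundberg + F: nonneg_distribution F
begin

definition kern :: "real \<Rightarrow> real" where
  "kern x = intensity * (1 - cdf F x)"

definition \<rho> :: real where
  "\<rho> = intensity * dist_mean F"

lemma measurable_kern [measurable]: "kern \<in> borel_measurable borel"
  unfolding kern_def[abs_def] by measurable

lemma kern_nonneg: "0 \<le> kern x"
  using intensity_pos F.cdf_bounded_prob by (simp add: kern_def)

lemma kern_set_integrable: "set_integrable lborel {0..} kern"
  unfolding kern_def[abs_def] by (intro set_integrable_mult_right F.tail_set_integrable)

lemma kern_set_integral: "(LBINT x:{0..}. kern x) = \<rho>"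
  unfolding kern_def \<rho>_def by (simp add: F.tail_set_integral)

lemma kern_set_integral_Icc: "(LBINT x:{0..u}. kern x) \<le> \<rho>"
  unfolding kern_set_integral[symmetric]
  using kern_set_integrable set_integrable_subset[OF kern_set_integrable, of "{0..u}"]
  unfolding set_lebesgue_integral_def set_integrable_def
  by (intro integral_mono) (auto simp: indicator_def kern_nonneg)

lemma \<rho>_pos: "0 < \<rho>"
  using intensity_pos F.mean_pos by (simp add: \<rho>_def)

text \<open>\<open>exponential_average_identity\<close> for the average \<open>h\<close> of
  \<open>surv n\<close> over the claim size, whose exponential average is
  \<open>surv (Suc n)\<close> by \<open>surv_Suc\<close>.\<close>

lemma surv_identity:
  assumes u: "0 \<le> u"
  shows "surv (Suc n) u + intensity * (LBINT y:{0..u}. surv n y * cdf F (u - y))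
    = surv (Suc n) 0 + intensity * (LBINT y:{0..u}. surv (Suc n) y)"
proof -
  define h where "h v = (\<integral>\<^sup>+x. ennreal (surv n (v - x)) \<partial>F)" for v
  have [measurable]: "h \<in> borel_measurable borel"
    unfolding h_def[abs_def] by measurable
  have A: "(\<integral>\<^sup>+w. ennreal (exponential_density intensity w) * h (v + w) \<partial>lborel) = ennreal (surv (Suc n) v)"
    if "0 \<le> v" for v
    using surv_Suc[OF that, of n] by (simp add: h_def)
  have "(\<integral>\<^sup>+v. h v * indicator {0..<u} v \<partial>lborel) = (\<integral>\<^sup>+v. h v * indicator {0..u} v \<partial>lborel)"
    using AE_lborel_singleton[of u]
    by (intro nn_integral_cong_AE) (auto elim!: eventually_mono simp: indicator_def)
  also have "\<dots> = (\<integral>\<^sup>+y. ennreal (surv n y * cdf F (u - y)) * indicator {0..u} y \<partial>lborel)"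
    unfolding h_def by (subst F.nn_integral_convolution_cdf) (auto simp: surv_eq_0 ennreal_mult'[symmetric] surv_nonneg)
  also have "\<dots> = ennreal (LBINT y:{0..u}. surv n y * cdf F (u - y))"
    by (rule nn_integral_Icc_eq_set_integral[where B = 1])
      (auto simp: surv_nonneg surv_le_1 F.cdf_nonneg F.cdf_bounded_prob mult_le_one)
  finally have h: "(\<integral>\<^sup>+v. h v * indicator {0..<u} v \<partial>lborel)
      = ennreal (LBINT y:{0..u}. surv n y * cdf F (u - y))" .
  have "(\<integral>\<^sup>+v. (\<integral>\<^sup>+w. ennreal (exponential_density intensity w) * h (v + w) \<partial>lborel) * indicator {0..u} v \<partial>lborel)
      = (\<integral>\<^sup>+v. ennreal (surv (Suc n) v) * indicator {0..u} v \<partial>lborel)"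
    by (intro nn_integral_cong) (auto simp: A indicator_def)
  also have "\<dots> = ennreal (LBINT y:{0..u}. surv (Suc n) y)"
    by (rule nn_integral_Icc_eq_set_integral[where B = 1]) (auto simp: surv_nonneg surv_le_1)
  finally have "ennreal (surv (Suc n) u) + ennreal intensity * ennreal (LBINT y:{0..u}. surv n y * cdf F (u - y))
      = ennreal (surv (Suc n) 0) + ennreal intensity * ennreal (LBINT y:{0..u}. surv (Suc n) y)"
    using exponential_average_identity[of h intensity u] intensity_pos u h A[of u] A[of 0] by simp
  moreover have "0 \<le> (LBINT y:{0..u}. surv n y * cdf F (u - y))" "0 \<le> (LBINT y:{0..u}. surv (Suc n) y)"
    unfolding set_lebesgue_integral_def
    by (auto intro!: Bochner_Integration.integral_nonneg simp: surv_nonneg F.cdf_nonneg)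
  ultimately show ?thesis
    using intensity_pos
    by (simp add: ennreal_mult'[symmetric] ennreal_plus[symmetric] surv_nonneg del: ennreal_plus)
qed

lemma survival_identity:
  assumes u: "0 \<le> u"
  shows "survival u + intensity * (LBINT y:{0..u}. survival y * cdf F (u - y))
    = survival 0 + intensity * (LBINT y:{0..u}. survival y)"
proof (rule LIMSEQ_unique)
  \<comment> \<open>The index map \<open>N\<close> is a parameter because the two integrals carry
    different horizons, \<open>n\<close> and \<open>Suc n\<close>.\<close>
  have dom: "(\<lambda>n. LBINT y:{0..u}. surv (N n) y * g y) \<longlonglongrightarrow> (LBINT y:{0..u}. survival y * g y)"
    if N: "filterlim N at_top sequentially" and [measurable]: "g \<in> borel_measurable borel"
      and g: "\<And>y. 0 \<le> g y \<and> g y \<le> 1" for N and g :: "real \<Rightarrow> real"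
    unfolding set_lebesgue_integral_def
  proof (rule integral_dominated_convergence[where w = "indicator {0..u}"])
    show "integrable lborel (indicator {0..u} :: real \<Rightarrow> real)"
      by (intro integrable_real_indicator) (auto simp: emeasure_lborel_Icc_eq)
    show "AE y in lborel. (\<lambda>n. indicator {0..u} y *\<^sub>R (surv (N n) y * g y))
        \<longlonglongrightarrow> indicator {0..u} y *\<^sub>R (survival y * g y)"
    proof (rule AE_I2)
      fix y
      have "(\<lambda>n. surv (N n) y) \<longlonglongrightarrow> survival y"
        by (rule filterlim_compose[OF surv_tendsto_survival N])
      then show "(\<lambda>n. indicator {0..u} y *\<^sub>R (surv (N n) y * g y))
          \<longlonglongrightarrow> indicator {0..u} y *\<^sub>R (survival y * g y)"
        by (intro tendsto_scaleR tendsto_mult tendsto_const)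
    qed
    show "AE y in lborel. norm (indicator {0..u} y *\<^sub>R (surv (N n) y * g y)) \<le> indicator {0..u} y" for n
      using g by (intro AE_I2) (auto simp: indicator_def surv_nonneg surv_le_1 abs_mult mult_le_one)
  qed measurable
  show "(\<lambda>n. surv (Suc n) u + intensity * (LBINT y:{0..u}. surv n y * cdf F (u - y)))
      \<longlonglongrightarrow> survival u + intensity * (LBINT y:{0..u}. survival y * cdf F (u - y))"
    using dom[of "\<lambda>n. n" "\<lambda>y. cdf F (u - y)"]
    by (intro tendsto_add tendsto_mult tendsto_const LIMSEQ_Suc[OF surv_tendsto_survival])
      (simp add: filterlim_ident F.cdf_nonneg F.cdf_bounded_prob)
  show "(\<lambda>n. surv (Suc n) u + intensity * (LBINT y:{0..u}. surv n y * cdf F (u - y)))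
      \<longlonglongrightarrow> survival 0 + intensity * (LBINT y:{0..u}. survival y)"
    unfolding surv_identity[OF u]
    using dom[OF filterlim_Suc, of "\<lambda>_. 1"]
    by (intro tendsto_add tendsto_mult tendsto_const LIMSEQ_Suc[OF surv_tendsto_survival]) simp
qed

text \<open>The two integrals in \<open>survival_identity\<close> differ by the factor
  \<open>1 - cdf F (u - y)\<close>, the kernel up to the intensity, and reflection gives the
  Volterra form. The value of \<open>survival 0\<close> is still open here.\<close>

lemma survival_renewal_0:
  assumes u: "0 \<le> u"
  shows "survival u = survival 0 + volterra kern survival u"
proof -
  have int: "set_integrable lborel {0..u} (\<lambda>y. survival y)"
      "set_integrable lborel {0..u} (\<lambda>y. survival y * cdf F (u - y))"
    by (auto intro!: nn_integral_Icc_eq_set_integral(1)[where B = 1]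
        simp: survival_nonneg survival_le_1 F.cdf_nonneg F.cdf_bounded_prob mult_le_one)
  have "volterra kern survival u = (LBINT y:{0..u}. survival (u - y) * kern (u - (u - y)))"
    by (simp add: volterra_def)
  also have "\<dots> = (LBINT y:{0..u}. survival y * kern (u - y))"
    by (rule set_integral_reflect_Icc[where g = "\<lambda>y. survival y * kern (u - y)"])
  also have "\<dots> = intensity * ((LBINT y:{0..u}. survival y) - (LBINT y:{0..u}. survival y * cdf F (u - y)))"
    unfolding set_integral_diff(2)[OF int, symmetric] set_integral_mult_right[symmetric]
    by (simp add: kern_def algebra_simps)
  finally show ?thesis using survival_identity[OF u] by (simp add: algebra_simps)
qed

text \<open>For fixed \<open>n\<close>, \<open>surv n\<close> tends to 1 at infinity without any law of large numbers; the resulting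
  bound at 0 is uniform in \<open>n\<close> and so survives the limit.\<close>

lemma survival_0_ge: "1 - \<rho> \<le> survival 0"
proof -
  have "1 \<le> surv (Suc n) 0 + \<rho>" for n
  proof (rule LIMSEQ_le_const2[OF surv_tendsto_1[of "Suc n"]], intro exI allI impI)
    fix j :: nat
    define u where "u = real j"
    have "0 \<le> u" by (simp add: u_def)
    have int: "set_integrable lborel {0..u} (\<lambda>y. surv (Suc n) y)"
        "set_integrable lborel {0..u} (\<lambda>y. surv n y * cdf F (u - y))"
        "set_integrable lborel {0..u} (\<lambda>y. 1 - cdf F (u - y))"
      by (auto intro!: nn_integral_Icc_eq_set_integral(1)[where B = 1]
        simp: surv_nonneg surv_le_1 F.cdf_nonneg F.cdf_bounded_prob mult_le_one)
    have "surv (Suc n) u - surv (Suc n) 0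
        = intensity * (LBINT y:{0..u}. surv (Suc n) y - surv n y * cdf F (u - y))"
      unfolding set_integral_diff(2)[OF int(1,2)] using surv_identity[OF \<open>0 \<le> u\<close>, of n]
      by (simp add: algebra_simps)
    also have "\<dots> \<le> intensity * (LBINT y:{0..u}. 1 - cdf F (u - y))"
    proof (intro mult_left_mono set_integral_mono int(3) set_integral_diff(1)[OF int(1,2)])
      fix y
      \<comment> \<open>Survival gets less likely as the horizon grows, so
        \<open>surv (Suc n) y\<close> may be replaced by \<open>surv n y\<close>.\<close>
      have "surv (Suc n) y - surv n y * cdf F (u - y) \<le> surv n y * (1 - cdf F (u - y))"
        using surv_Suc_le[of n y] by (simp add: algebra_simps)
      also have "\<dots> \<le> 1 * (1 - cdf F (u - y))"
        by (intro mult_right_mono) (auto simp: surv_le_1 F.cdf_bounded_prob)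
      finally show "surv (Suc n) y - surv n y * cdf F (u - y) \<le> 1 - cdf F (u - y)" by simp
    qed (use intensity_pos in auto)
    also have "\<dots> = (LBINT y:{0..u}. kern y)"
      unfolding set_integral_reflect_Icc[where g = "\<lambda>y. 1 - cdf F y"] kern_def by simp
    also have "\<dots> \<le> \<rho>" by (rule kern_set_integral_Icc)
    finally show "surv (Suc n) (real j) \<le> surv (Suc n) 0 + \<rho>" by (simp add: u_def)
  qed
  then have "1 - \<rho> \<le> surv (Suc n) 0" for n by (simp add: algebra_simps)
  then show ?thesis
    by (intro LIMSEQ_le_const[OF LIMSEQ_Suc[OF surv_tendsto_survival]]) blast
qed

section \<open>The Pollaczek-Khinchine series and the survival probability at zero\<close>

abbreviation "conv_tail \<equiv> conv_power (integrated_tail F)"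

lemma conv_tail_distribution: "real_distribution (conv_tail n)"
  and conv_tail_neg: "u < 0 \<Longrightarrow> cdf (conv_tail n) u = 0"
proof (induction n arbitrary: u)
  case 0
  {
    case 1
    show ?case
      by (simp add: real_distribution_def real_distribution_axioms_def prob_space_return)
  next
    case 2
    then show ?case by (simp add: cdf_def measure_return)
  }
next
  case (Suc n)
  interpret T: real_distribution "integrated_tail F" by (rule F.real_distribution_integrated_tail)
  interpret N: real_distribution "conv_tail n" by (rule Suc)
  interpret TN: pair_prob_space "integrated_tail F" "conv_tail n" ..
  {
    case 1
    show ?case unfolding conv_power.simps convolution_def
      by (rule TN.real_distribution_distr) simp
  next
    case 2
    have "emeasure (conv_tail (Suc n)) {..u} = (\<integral>\<^sup>+x. emeasure (conv_tail n) {a. a + x \<in> {..u}} \<partial>integrated_tail F)"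
      unfolding conv_power.simps
      by (rule convolution_emeasure)
        (auto simp: T.finite_measure_axioms N.finite_measure_axioms)
    also have "\<dots> = (\<integral>\<^sup>+x. ennreal (cdf (conv_tail n) (u - x)) \<partial>integrated_tail F)"
      by (intro nn_integral_cong) (auto simp: cdf_def N.emeasure_eq_measure intro!: arg_cong[where f = N.prob])
    also have "\<dots> = (\<integral>\<^sup>+t. 0 \<partial>(lborel :: real measure))"
      using 2 Suc(2) borel_measurable_cdf[OF Suc(1)]
      by (subst F.nn_integral_integrated_tail, simp, intro nn_integral_cong) (simp add: indicator_def)
    finally show ?case by (simp add: cdf_def measure_def)
  }
qed

text \<open>On the half-line \<open>kern\<close> is \<open>\<rho>\<close> times the density of the
  integrated tail, so convolving with that law is the Volterra operator divided by
  \<open>\<rho>\<close>. Vanishing on negative arguments cuts the integral down to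
  \<open>{0..u}\<close>.\<close>

lemma cdf_conv_tail_Suc:
  assumes u: "0 \<le> u"
  shows "\<rho> * cdf (conv_tail (Suc n)) u = volterra kern (cdf (conv_tail n)) u"
proof -
  interpret T: real_distribution "integrated_tail F" by (rule F.real_distribution_integrated_tail)
  interpret N: real_distribution "conv_tail n" by (rule conv_tail_distribution)
  interpret N': real_distribution "conv_tail (Suc n)" by (rule conv_tail_distribution)
  note [measurable] = borel_measurable_cdf[OF conv_tail_distribution]
  have "ennreal (cdf (conv_tail (Suc n)) u) = emeasure (conv_tail (Suc n)) {..u}"
    by (simp add: cdf_def N'.emeasure_eq_measure del: conv_power.simps)
  also have "\<dots> = (\<integral>\<^sup>+x. emeasure (conv_tail n) {a. a + x \<in> {..u}} \<partial>integrated_tail F)"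
    unfolding conv_power.simps
    by (rule convolution_emeasure)
      (auto simp: T.finite_measure_axioms N.finite_measure_axioms)
  also have "\<dots> = (\<integral>\<^sup>+x. ennreal (cdf (conv_tail n) (u - x)) \<partial>integrated_tail F)"
    by (intro nn_integral_cong) (auto simp: cdf_def N.emeasure_eq_measure intro!: arg_cong[where f = N.prob])
  also have "\<dots> = (\<integral>\<^sup>+t. ennreal (cdf (conv_tail n) (u - t) * ((1 - cdf F t) / dist_mean F)) * indicator {0..u} t \<partial>lborel)"
    using F.mean_pos
    by (subst F.nn_integral_integrated_tail)
      (auto simp: indicator_def conv_tail_neg ennreal_mult'[symmetric] N.cdf_nonneg F.cdf_bounded_prob mult.commute
        intro!: nn_integral_cong)
  also have "\<dots> = ennreal (LBINT t:{0..u}. cdf (conv_tail n) (u - t) * ((1 - cdf F t) / dist_mean F))"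
    using F.mean_pos
    by (intro nn_integral_Icc_eq_set_integral(2)[where B = "1 / dist_mean F"])
      (auto simp: N.cdf_nonneg N.cdf_bounded_prob F.cdf_bounded_prob F.cdf_nonneg
        intro!: divide_right_mono mult_le_one)
  finally have "cdf (conv_tail (Suc n)) u = (LBINT t:{0..u}. cdf (conv_tail n) (u - t) * ((1 - cdf F t) / dist_mean F))"
    using F.mean_pos
    by (subst (asm) ennreal_inj) (auto simp: N'.cdf_nonneg N.cdf_nonneg F.cdf_bounded_prob
        set_lebesgue_integral_def simp del: conv_power.simps intro!: Bochner_Integration.integral_nonneg)
  then have "\<rho> * cdf (conv_tail (Suc n)) u
      = (LBINT t:{0..u}. \<rho> * (cdf (conv_tail n) (u - t) * ((1 - cdf F t) / dist_mean F)))"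
    by (simp only: set_integral_mult_right)
  moreover have "\<rho> * (cdf (conv_tail n) (u - t) * ((1 - cdf F t) / dist_mean F))
      = cdf (conv_tail n) (u - t) * kern t" for t
    using F.mean_pos by (simp add: kern_def \<rho>_def)
  ultimately show ?thesis by (simp only: volterra_def)
qed

text \<open>The Volterra operator raises the convolution power by one, so the partial sums are
  Picard iterates of \<open>survival_renewal_0\<close>, started at the constant
  \<open>survival 0\<close>. That prefactor is evaluated only afterwards.\<close>

lemma survival_sums_conv_tail:
  assumes "\<rho> < 1" and u: "0 \<le> u"
  shows "(\<lambda>k. survival 0 * (\<rho> ^ k * cdf (conv_tail k) u)) sums survival u"
proof -
  interpret N: real_distribution "conv_tail k" for k by (rule conv_tail_distribution)
  note [measurable] = borel_measurable_cdf[OF conv_tail_distribution]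
  define g where "g n v = (\<Sum>k<Suc n. survival 0 * (\<rho> ^ k * cdf (conv_tail k) v))" for n v
  have [measurable]: "g n \<in> borel_measurable borel" for n unfolding g_def[abs_def] by measurable
  have bound: "\<bar>survival 0 * (\<rho> ^ k * cdf (conv_tail k) v)\<bar> \<le> \<rho> ^ k" for k v
  proof -
    have "survival 0 * (\<rho> ^ k * cdf (conv_tail k) v) \<le> 1 * (\<rho> ^ k * 1)"
      using survival_le_1 N.cdf_bounded_prob \<rho>_pos N.cdf_nonneg by (intro mult_mono) auto
    then show ?thesis using survival_nonneg N.cdf_nonneg \<rho>_pos by simp
  qed
  have g_bound: "\<bar>g n v\<bar> \<le> 1 / (1 - \<rho>)" for n v
  proof -
    have "\<bar>g n v\<bar> \<le> (\<Sum>k<Suc n. \<rho> ^ k)"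
      unfolding g_def by (rule order_trans[OF sum_abs]) (intro sum_mono bound)
    also have "\<dots> \<le> (\<Sum>k. \<rho> ^ k)"
      using \<rho>_pos \<open>\<rho> < 1\<close> by (intro sum_le_suminf) auto
    also have "\<dots> = 1 / (1 - \<rho>)"
      using \<rho>_pos \<open>\<rho> < 1\<close> by (intro suminf_geometric) auto
    finally show ?thesis .
  qed
  have "(\<lambda>n. g n u) \<longlonglongrightarrow> survival u"
  proof (rule picard_iteration_tendsto[where k = kern and f = survival and g = g and u = u and c = "survival 0" and B = 1 and B' = "1 / (1 - \<rho>)"])
    show "(LBINT x:{0..}. kern x) < 1" using \<open>\<rho> < 1\<close> by (simp add: kern_set_integral)
    show "g (Suc n) v = survival 0 + volterra kern (g n) v" if v: "0 \<le> v" "v \<le> u" for n v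
    proof -
      have int: "set_integrable lborel {0..v} (\<lambda>x. survival 0 * (\<rho> ^ k * cdf (conv_tail k) (v - x)) * kern x)" for k
        by (rule set_integrable_volterra[where B = "\<rho> ^ k" and f = "\<lambda>x. survival 0 * (\<rho> ^ k * cdf (conv_tail k) x)"])
          (auto simp: kern_set_integrable bound simp del: conv_power.simps)
      have "volterra kern (g n) v
          = (\<Sum>k<Suc n. LBINT x:{0..v}. survival 0 * (\<rho> ^ k * cdf (conv_tail k) (v - x)) * kern x)"
        using int unfolding volterra_def g_def sum_distrib_right set_lebesgue_integral_def set_integrable_def
          scaleR_sum_right
        by (intro Bochner_Integration.integral_sum) auto
      also have "\<dots> = (\<Sum>k<Suc n. survival 0 * (\<rho> ^ Suc k * cdf (conv_tail (Suc k)) v))"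
      proof (intro sum.cong refl)
        fix k
        have "(LBINT x:{0..v}. survival 0 * (\<rho> ^ k * cdf (conv_tail k) (v - x)) * kern x)
            = (LBINT x:{0..v}. (survival 0 * \<rho> ^ k) * (cdf (conv_tail k) (v - x) * kern x))"
          by (simp only: mult.assoc)
        also have "\<dots> = (survival 0 * \<rho> ^ k) * volterra kern (cdf (conv_tail k)) v"
          by (simp only: set_integral_mult_right volterra_def)
        also have "\<dots> = survival 0 * (\<rho> ^ Suc k * cdf (conv_tail (Suc k)) v)"
          unfolding cdf_conv_tail_Suc[OF v(1), symmetric] by (simp add: mult_ac del: conv_power.simps)
        finally show "(LBINT x:{0..v}. survival 0 * (\<rho> ^ k * cdf (conv_tail k) (v - x)) * kern x)
            = survival 0 * (\<rho> ^ Suc k * cdf (conv_tail (Suc k)) v)" .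
      qed
      finally have "survival 0 + volterra kern (g n) v
          = survival 0 * (\<rho> ^ 0 * cdf (conv_tail 0) v)
            + (\<Sum>k<Suc n. survival 0 * (\<rho> ^ Suc k * cdf (conv_tail (Suc k)) v))"
        using v by (simp add: cdf_def measure_return)
      also have "\<dots> = g (Suc n) v"
        unfolding g_def by (subst (2) sum.lessThan_Suc_shift) (rule refl)
      finally show ?thesis ..
    qed
    show "\<bar>g n v\<bar> \<le> 1 / (1 - \<rho>)" for n v by (rule g_bound)
    show "survival v = survival 0 + volterra kern survival v" if "0 \<le> v" for v
      using that by (rule survival_renewal_0)
  qed (use u in \<open>auto simp: kern_nonneg kern_set_integrable survival_nonneg survival_le_1\<close>)
  then show ?thesis unfolding sums_def g_def by (rule LIMSEQ_imp_Suc)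
qed

text \<open>For the upper bound, \<open>survival\<close> is at most 1, and letting the reserve tend
  to infinity in a partial sum replaces each cdf by 1. The geometric series then gives
  \<open>survival 0 / (1 - \<rho>) \<le> 1\<close>.\<close>

lemma survival_0:
  assumes "\<rho> < 1"
  shows "survival 0 = 1 - \<rho>"
proof (rule antisym[OF _ survival_0_ge])
  interpret N: real_distribution "conv_tail k" for k by (rule conv_tail_distribution)
  have "(\<Sum>k<n. survival 0 * \<rho> ^ k) \<le> 1" for n
  proof (rule LIMSEQ_le_const2)
    show "(\<lambda>j. \<Sum>k<n. survival 0 * (\<rho> ^ k * cdf (conv_tail k) (real j))) \<longlonglongrightarrow> (\<Sum>k<n. survival 0 * \<rho> ^ k)"
    proof (rule tendsto_sum)
      fix k
      have "(\<lambda>j. survival 0 * (\<rho> ^ k * cdf (conv_tail k) (real j))) \<longlonglongrightarrow> survival 0 * (\<rho> ^ k * 1)"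
        by (intro tendsto_mult tendsto_const N.cdf_lim_infty_prob)
      then show "(\<lambda>j. survival 0 * (\<rho> ^ k * cdf (conv_tail k) (real j))) \<longlonglongrightarrow> survival 0 * \<rho> ^ k"
        by simp
    qed
    have "(\<Sum>k<n. survival 0 * (\<rho> ^ k * cdf (conv_tail k) (real j))) \<le> 1" for j
    proof -
      note sums = survival_sums_conv_tail[OF assms, of "real j"]
      have "(\<Sum>k<n. survival 0 * (\<rho> ^ k * cdf (conv_tail k) (real j)))
          \<le> (\<Sum>k. survival 0 * (\<rho> ^ k * cdf (conv_tail k) (real j)))"
        using sums_summable[OF sums] survival_nonneg N.cdf_nonneg \<rho>_pos by (intro sum_le_suminf) auto
      also have "\<dots> = survival (real j)" using sums by (intro sums_unique[symmetric]) simp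
      also have "\<dots> \<le> 1" by (rule survival_le_1)
      finally show ?thesis .
    qed
    then show "\<exists>N. \<forall>j\<ge>N. (\<Sum>k<n. survival 0 * (\<rho> ^ k * cdf (conv_tail k) (real j))) \<le> 1" by blast
  qed
  moreover have "(\<lambda>n. \<Sum>k<n. survival 0 * \<rho> ^ k) \<longlonglongrightarrow> survival 0 * (1 / (1 - \<rho>))"
    using sums_mult[OF geometric_sums[of \<rho>], of "survival 0"] \<rho>_pos assms by (simp add: sums_def)
  ultimately have "survival 0 * (1 / (1 - \<rho>)) \<le> 1"
    by (intro LIMSEQ_le_const2[of _ _ 1]) auto
  then show "survival 0 \<le> 1 - \<rho>" using assms by (simp add: field_simps)
qed

lemma survival_renewal:
  assumes "\<rho> < 1" "0 \<le> u"
  shows "survival u = (1 - \<rho>) + volterra kern survival u"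
  using survival_renewal_0[OF assms(2)] survival_0[OF assms(1)] by simp

lemma pk_ruin_eq_survival:
  assumes "\<rho> < 1" and u: "0 \<le> u"
  shows "pk_ruin \<rho> (integrated_tail F) u = 1 - survival u"
proof -
  have "(\<lambda>k. (1 - \<rho>) * \<rho> ^ k) sums ((1 - \<rho>) * (1 / (1 - \<rho>)))"
    using \<rho>_pos assms(1) by (intro sums_mult geometric_sums) simp
  then have "(\<lambda>k. (1 - \<rho>) * \<rho> ^ k) sums 1" using assms(1) by simp
  from sums_diff[OF this survival_sums_conv_tail[OF assms]]
  have "(\<lambda>k. (1 - \<rho>) * (\<rho> ^ k * (1 - cdf (conv_tail k) u))) sums (1 - survival u)"
    unfolding survival_0[OF assms(1)] by (simp add: algebra_simps)
  then have "(\<lambda>k. \<rho> ^ k * (1 - cdf (conv_tail k) u)) sums ((1 - survival u) / (1 - \<rho>))"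
    using assms(1) sums_mult_D[of "1 - \<rho>"] by fastforce
  \<comment> \<open>The term at index 0 vanishes because \<open>conv_tail 0\<close> is the point
    mass at 0 and \<open>u \<ge> 0\<close>, so the index shift leaves the sum unchanged.\<close>
  then have "(\<lambda>k. \<rho> ^ Suc k * (1 - cdf (conv_tail (Suc k)) u)) sums ((1 - survival u) / (1 - \<rho>))"
    using u by (subst sums_Suc_iff) (simp add: cdf_def measure_return)
  then show ?thesis
    unfolding pk_ruin_def using assms(1) by (subst sums_unique[symmetric]) auto
qed

theorem pollaczek_khinchine:
  assumes "\<rho> < 1" "0 \<le> u"
  shows "ruin_prob M W X u = pk_ruin \<rho> (integrated_tail F) u"
  using ruin_prob_eq_survival pk_ruin_eq_survival assms by simp

end

section \<open>Poisson mixtures and Erlang claims\<close>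

definition pois :: "nat \<Rightarrow> real \<Rightarrow> real" where
  "pois n y = y ^ n * exp (- y) / fact n"

lemma pois_nonneg: "0 \<le> y \<Longrightarrow> 0 \<le> pois n y"
  by (simp add: pois_def)

lemma measurable_pois [measurable]: "pois n \<in> borel_measurable borel"
  unfolding pois_def[abs_def] by measurable

text \<open>The Poisson generating function, the majorant for mixtures whose coefficients grow at
  most like \<open>b ^ n\<close>.\<close>

lemma power_pois_sums: "(\<lambda>n. b ^ n * pois n y) sums exp (b * y - y)"
proof -
  have "(\<lambda>n. exp (- y) * ((b * y) ^ n /\<^sub>R fact n)) sums (exp (- y) * exp (b * y))"
    by (intro sums_mult exp_converges)
  then show ?thesis
    by (simp add: pois_def exp_diff exp_minus field_simps power_mult_distrib)
qed

lemma pois_sums: "(\<lambda>n. pois n y) sums 1"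
  using power_pois_sums[of 1 y] by simp

lemma erlang_density_eq_pois: "0 \<le> x \<Longrightarrow> erlang_density n \<theta> x = \<theta> * pois n (\<theta> * x)"
  by (simp add: erlang_density_def pois_def power_mult_distrib)

text \<open>Up to a factor \<open>\<theta>\<close>, \<open>pois n\<close> is the Erlang density of
  shape \<open>Suc n\<close>, and shapes add under convolution, hence the index
  \<open>Suc (m + i)\<close>. Two factors \<open>\<theta>\<close> are divided out and one comes
  back.\<close>

lemma nn_integral_pois_convolution:
  assumes "0 < \<theta>" "0 \<le> u"
  shows "(\<integral>\<^sup>+x. ennreal (pois m (\<theta> * (u - x)) * pois i (\<theta> * x)) * indicator {0..u} x \<partial>lborel)
    = ennreal (pois (Suc (m + i)) (\<theta> * u) / \<theta>)"
proof -
  have "ennreal (1 / \<theta>\<^sup>2) * (ennreal (erlang_density m \<theta> (u - x)) * ennreal (erlang_density i \<theta> x))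
      = ennreal (pois m (\<theta> * (u - x)) * pois i (\<theta> * x)) * indicator {0..u} x" for x
  proof (cases "0 \<le> x \<and> x \<le> u")
    case True
    then show ?thesis
      using assms by (simp add: erlang_density_eq_pois ennreal_mult'[symmetric] pois_nonneg power2_eq_square)
  next
    case False
    then show ?thesis by (auto simp: erlang_density_def indicator_def)
  qed
  then have "(\<integral>\<^sup>+x. ennreal (pois m (\<theta> * (u - x)) * pois i (\<theta> * x)) * indicator {0..u} x \<partial>lborel)
      = ennreal (1 / \<theta>\<^sup>2) * (\<integral>\<^sup>+x. ennreal (erlang_density m \<theta> (u - x)) * ennreal (erlang_density i \<theta> x) \<partial>lborel)"
    by (subst nn_integral_cmult[symmetric]) auto
  also have "\<dots> = ennreal (1 / \<theta>\<^sup>2) * ennreal (erlang_density (Suc (m + i)) \<theta> u)"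
    using fun_cong[OF convolution_erlang_density[of \<theta> m i], of u] assms by simp
  also have "\<dots> = ennreal (pois (Suc (m + i)) (\<theta> * u) / \<theta>)"
    using assms by (simp add: erlang_density_eq_pois ennreal_mult'[symmetric] power2_eq_square)
  finally show ?thesis .
qed

lemma summable_pois_mult:
  assumes "\<And>n. \<bar>a n\<bar> \<le> b ^ n" "0 \<le> y"
  shows "summable (\<lambda>n. \<bar>a n * pois n y\<bar>)"
proof (rule summable_comparison_test'[OF sums_summable[OF power_pois_sums[of b y]]])
  fix n show "norm \<bar>a n * pois n y\<bar> \<le> b ^ n * pois n y"
    using assms by (simp add: abs_mult pois_nonneg mult_right_mono)
qed

text \<open>The integrand is a Cauchy product of two mixtures. Integration sends its
  \<open>n\<close>-th term to index \<open>Suc n\<close>, where by \<open>\<eta>_rec\<close> the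
  coefficient is \<open>\<eta> (Suc n) - c\<close>. The growth bound \<open>b ^ n\<close> yields
  convergence and the local boundedness needed for uniqueness.\<close>

lemma pois_mixture_renewal:
  fixes c l \<theta> b :: real and \<eta> C :: "nat \<Rightarrow> real" and k :: "real \<Rightarrow> real"
  assumes \<theta>: "0 < \<theta>" and l: "0 \<le> l" and c: "0 \<le> c"
    and C: "\<And>i. 0 \<le> C i" "\<And>i. C i \<le> 1"
    and \<eta>: "\<And>n. 0 \<le> \<eta> n" "\<And>n. \<eta> n \<le> b ^ n" and b: "1 \<le> b"
    and \<eta>_rec: "\<And>n. \<eta> n = c + l / \<theta> * (\<Sum>i<n. C i * \<eta> (n - 1 - i))"
    and [measurable]: "k \<in> borel_measurable borel"
    and k: "\<And>x. 0 \<le> x \<Longrightarrow> (\<lambda>i. l * (C i * pois i (\<theta> * x))) sums k x"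
    and u: "0 \<le> u"
  defines "\<Phi> \<equiv> \<lambda>v. \<Sum>n. \<eta> n * pois n (\<theta> * v)"
  shows "\<Phi> \<in> borel_measurable borel"
    and "\<And>v. 0 \<le> v \<Longrightarrow> (\<lambda>n. \<eta> n * pois n (\<theta> * v)) sums \<Phi> v"
    and "\<And>v. 0 \<le> v \<Longrightarrow> 0 \<le> \<Phi> v"
    and "\<And>v. 0 \<le> v \<Longrightarrow> v \<le> u \<Longrightarrow> \<Phi> v \<le> exp (b * (\<theta> * u))"
    and "\<Phi> u = c + volterra k \<Phi> u"
proof -
  show [measurable]: "\<Phi> \<in> borel_measurable borel"
    unfolding \<Phi>_def by measurable
  have \<eta>_abs: "\<bar>\<eta> n\<bar> \<le> b ^ n" for n using \<eta> by simp
  have C_abs: "\<bar>C i\<bar> \<le> 1 ^ i" for i using C by simp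
  have sm: "summable (\<lambda>n. \<bar>\<eta> n * pois n (\<theta> * v)\<bar>)" if "0 \<le> v" for v
    using that \<theta> by (intro summable_pois_mult[OF \<eta>_abs]) simp
  show \<Phi>_sums: "(\<lambda>n. \<eta> n * pois n (\<theta> * v)) sums \<Phi> v" if "0 \<le> v" for v
    unfolding \<Phi>_def using summable_rabs_cancel[OF sm[OF that]] by (rule summable_sums)
  show \<Phi>_nonneg: "0 \<le> \<Phi> v" if "0 \<le> v" for v
    by (rule sums_le[OF _ sums_zero \<Phi>_sums[OF that]]) (use \<eta> \<theta> that in \<open>auto intro!: mult_nonneg_nonneg pois_nonneg\<close>)
  show \<Phi>_le: "\<Phi> v \<le> exp (b * (\<theta> * u))" if "0 \<le> v" "v \<le> u" for v
  proof -
    have "\<Phi> v \<le> exp (b * (\<theta> * v) - \<theta> * v)"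
      by (rule sums_le[OF _ \<Phi>_sums[OF that(1)] power_pois_sums])
        (use \<eta> \<theta> that in \<open>auto intro!: mult_right_mono pois_nonneg\<close>)
    also have "\<dots> \<le> exp (b * (\<theta> * u))"
    proof -
      have "b * (\<theta> * v) \<le> b * (\<theta> * u)" "0 \<le> \<theta> * v"
        using that \<theta> b by (auto intro!: mult_left_mono)
      then show ?thesis by simp
    qed
    finally show ?thesis .
  qed
  have k_bounds: "0 \<le> k x \<and> k x \<le> l" if "0 \<le> x" for x
  proof
    have y: "0 \<le> \<theta> * x" using that \<theta> by simp
    show "0 \<le> k x"
      by (rule sums_le[OF _ sums_zero k[OF that]]) (use C l y in \<open>auto intro!: mult_nonneg_nonneg pois_nonneg\<close>)
    have "k x \<le> l * 1"
    proof (rule sums_le[OF _ k[OF that] sums_mult[OF pois_sums]])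
      show "l * (C n * pois n (\<theta> * x)) \<le> l * pois n (\<theta> * x)" for n
        using C l y by (intro mult_left_mono) (auto intro: mult_left_le_one_le pois_nonneg)
    qed
    then show "k x \<le> l" by simp
  qed
  \<comment> \<open>The \<open>n\<close>-th term of the Cauchy product of the series for
    \<open>\<Phi> (u - x)\<close> and \<open>k x\<close>.\<close>
  define t where "t n x = (\<Sum>i\<le>n. \<eta> i * pois i (\<theta> * (u - x)) * (l * (C (n - i) * pois (n - i) (\<theta> * x))))" for n x
  have [measurable]: "t n \<in> borel_measurable borel" for n unfolding t_def[abs_def] by measurable
  have t_nonneg: "0 \<le> t n x" if "0 \<le> x" "x \<le> u" for n x
    unfolding t_def using that \<eta> C l \<theta> by (auto intro!: sum_nonneg mult_nonneg_nonneg pois_nonneg)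
  have t_sums: "(\<lambda>n. t n x) sums (\<Phi> (u - x) * k x)" if x: "0 \<le> x" "x \<le> u" for x
  proof -
    have "summable (\<lambda>i. \<bar>l * (C i * pois i (\<theta> * x))\<bar>)"
      using summable_mult[OF summable_pois_mult[OF C_abs, of "\<theta> * x"], of l] \<theta> l x by (simp add: abs_mult)
    then have "(\<lambda>n. t n x) sums ((\<Sum>n. \<eta> n * pois n (\<theta> * (u - x))) * (\<Sum>i. l * (C i * pois i (\<theta> * x))))"
      unfolding t_def using sm[of "u - x"] x by (intro Cauchy_product_sums) auto
    then show ?thesis using sums_unique[OF k[OF x(1)]] by (simp add: \<Phi>_def)
  qed
  have \<eta>_ge: "c \<le> \<eta> n" for n
  proof -
    have "0 \<le> l / \<theta> * (\<Sum>i<n. C i * \<eta> (n - 1 - i))"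
      using l \<theta> C \<eta> by (intro mult_nonneg_nonneg sum_nonneg divide_nonneg_pos)
    then show ?thesis using \<eta>_rec[of n] by simp
  qed
  have \<eta>_0: "\<eta> 0 = c" using \<eta>_rec[of 0] by simp
  have t_integral: "(\<integral>\<^sup>+x. ennreal (t n x) * indicator {0..u} x \<partial>lborel)
      = ennreal ((\<eta> (Suc n) - c) * pois (Suc n) (\<theta> * u))" for n
  proof -
    have "(\<integral>\<^sup>+x. ennreal (t n x) * indicator {0..u} x \<partial>lborel)
        = (\<integral>\<^sup>+x. (\<Sum>i\<le>n. ennreal (\<eta> i * (l * C (n - i))) *
            (ennreal (pois i (\<theta> * (u - x)) * pois (n - i) (\<theta> * x)) * indicator {0..u} x)) \<partial>lborel)"
    proof (rule nn_integral_cong)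
      fix x
      show "ennreal (t n x) * indicator {0..u} x = (\<Sum>i\<le>n. ennreal (\<eta> i * (l * C (n - i))) *
            (ennreal (pois i (\<theta> * (u - x)) * pois (n - i) (\<theta> * x)) * indicator {0..u} x))"
      proof (cases "x \<in> {0..u}")
        case True
        show ?thesis
        proof -
          have t: "t n x = (\<Sum>i\<le>n. \<eta> i * (l * C (n - i)) * (pois i (\<theta> * (u - x)) * pois (n - i) (\<theta> * x)))"
            unfolding t_def by (intro sum.cong) (simp_all only: mult_ac)
          have nonneg: "0 \<le> pois i (\<theta> * (u - x)) * pois j (\<theta> * x)" "0 \<le> \<eta> i * (l * C j)" for i j
            using True \<theta> \<eta> C l by (auto intro!: mult_nonneg_nonneg pois_nonneg)
          have "ennreal (t n x) = (\<Sum>i\<le>n. ennreal (\<eta> i * (l * C (n - i)) * (pois i (\<theta> * (u - x)) * pois (n - i) (\<theta> * x))))"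
            unfolding t by (rule sum_ennreal[symmetric]) (intro mult_nonneg_nonneg nonneg)
          then show ?thesis using True by (simp only: ennreal_mult[OF nonneg(2,1)] indicator_simps mult_1_right)
        qed
      qed simp
    qed
    also have "\<dots> = (\<Sum>i\<le>n. ennreal (\<eta> i * (l * C (n - i))) * ennreal (pois (Suc n) (\<theta> * u) / \<theta>))"
      using \<theta> u
      by (subst nn_integral_sum, simp, subst nn_integral_cmult, simp)
        (auto simp: nn_integral_pois_convolution intro!: sum.cong)
    also have "\<dots> = ennreal (\<Sum>i\<le>n. \<eta> i * (l * C (n - i)) * (pois (Suc n) (\<theta> * u) / \<theta>))"
      using \<theta> u \<eta> C l
      by (subst sum_ennreal[symmetric])
        (auto intro!: sum.cong mult_nonneg_nonneg divide_nonneg_pos pois_nonneg simp: ennreal_mult'[symmetric])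
    also have "(\<Sum>i\<le>n. \<eta> i * (l * C (n - i)) * (pois (Suc n) (\<theta> * u) / \<theta>))
        = l / \<theta> * (\<Sum>i\<le>n. C (n - i) * \<eta> i) * pois (Suc n) (\<theta> * u)"
      unfolding sum_distrib_left sum_distrib_right by (intro sum.cong) auto
    also have "(\<Sum>i\<le>n. C (n - i) * \<eta> i) = (\<Sum>i<Suc n. C i * \<eta> (Suc n - 1 - i))"
      unfolding lessThan_Suc_atMost
      by (rule sum.reindex_bij_witness[where i = "\<lambda>i. n - i" and j = "\<lambda>i. n - i"]) auto
    also have "l / \<theta> * \<dots> = \<eta> (Suc n) - c" using \<eta>_rec[of "Suc n"] by simp
    finally show ?thesis .
  qed
  have "ennreal (volterra k \<Phi> u) = (\<integral>\<^sup>+x. ennreal (\<Phi> (u - x) * k x) * indicator {0..u} x \<partial>lborel)"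
    unfolding volterra_def
  proof (rule nn_integral_Icc_eq_set_integral(2)[symmetric])
    fix x assume "0 \<le> x" "x \<le> u"
    then show "0 \<le> \<Phi> (u - x) * k x \<and> \<Phi> (u - x) * k x \<le> exp (b * (\<theta> * u)) * l"
      using \<Phi>_nonneg[of "u - x"] \<Phi>_le[of "u - x"] k_bounds[of x]
      by (intro conjI mult_nonneg_nonneg mult_mono) auto
  qed measurable
  also have "\<dots> = (\<integral>\<^sup>+x. (\<Sum>n. ennreal (t n x) * indicator {0..u} x) \<partial>lborel)"
  proof (rule nn_integral_cong)
    fix x
    show "ennreal (\<Phi> (u - x) * k x) * indicator {0..u} x = (\<Sum>n. ennreal (t n x) * indicator {0..u} x)"
    proof (cases "x \<in> {0..u}")
      case True
      then have "(\<lambda>n. ennreal (t n x)) sums ennreal (\<Phi> (u - x) * k x)"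
        using t_sums t_nonneg \<Phi>_nonneg k_bounds by (subst sums_ennreal) auto
      then show ?thesis using True sums_unique by simp
    qed simp
  qed
  also have "\<dots> = (\<Sum>n. ennreal ((\<eta> (Suc n) - c) * pois (Suc n) (\<theta> * u)))"
    by (subst nn_integral_suminf) (simp_all add: t_integral)
  also have "\<dots> = ennreal (\<Phi> u - c)"
  proof -
    \<comment> \<open>Poisson weights sum to 1, so \<open>c\<close> is itself the mixture with
      constant coefficients \<open>c\<close>; the term at index 0 then cancels by
      \<open>\<eta>_0\<close>.\<close>
    have "(\<lambda>n. \<eta> n * pois n (\<theta> * u) - c * pois n (\<theta> * u)) sums (\<Phi> u - c * 1)"
      using u by (intro sums_diff \<Phi>_sums sums_mult pois_sums)
    then have "(\<lambda>n. (\<eta> (Suc n) - c) * pois (Suc n) (\<theta> * u)) sums (\<Phi> u - c)"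
      by (subst sums_Suc_iff) (simp add: \<eta>_0 left_diff_distrib)
    moreover have nonneg: "0 \<le> (\<eta> (Suc n) - c) * pois (Suc n) (\<theta> * u)" for n
      using \<eta>_ge[of "Suc n"] \<theta> u by (intro mult_nonneg_nonneg pois_nonneg) auto
    moreover have "0 \<le> \<Phi> u - c" using sums_le[OF nonneg sums_zero calculation(1)] .
    ultimately have "(\<lambda>n. ennreal ((\<eta> (Suc n) - c) * pois (Suc n) (\<theta> * u))) sums ennreal (\<Phi> u - c)"
      by (subst sums_ennreal) auto
    then show ?thesis by (rule sums_unique[symmetric])
  qed
  finally have *: "ennreal (volterra k \<Phi> u) = ennreal (\<Phi> u - c)" .
  moreover have "0 \<le> volterra k \<Phi> u"
    unfolding volterra_def set_lebesgue_integral_def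
    using \<Phi>_nonneg k_bounds by (intro Bochner_Integration.integral_nonneg) (auto simp: indicator_def)
  moreover have "0 \<le> \<Phi> u - c"
  proof -
    have "c * 1 \<le> \<Phi> u"
    proof (rule sums_le[OF _ sums_mult[OF pois_sums] \<Phi>_sums[OF u]])
      show "c * pois n (\<theta> * u) \<le> \<eta> n * pois n (\<theta> * u)" for n
        using \<eta>_ge \<theta> u by (intro mult_right_mono pois_nonneg) auto
    qed
    then show ?thesis by simp
  qed
  ultimately show "\<Phi> u = c + volterra k \<Phi> u" by simp
qed

section \<open>Binomial identities and Poisson thinning\<close>

lemma bin_mass_Suc:
  assumes "0 \<le> p" "p \<le> 1"
  shows "bin_mass 0 (Suc n) p = (1 - p) * bin_mass 0 n p"
    and "bin_mass (Suc k) (Suc n) p = p * bin_mass k n p + (1 - p) * bin_mass (Suc k) n p"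
proof -
  show "bin_mass 0 (Suc n) p = (1 - p) * bin_mass 0 n p"
    using assms by (simp add: bin_mass_def)
  show "bin_mass (Suc k) (Suc n) p = p * bin_mass k n p + (1 - p) * bin_mass (Suc k) n p"
  proof (cases "Suc k \<le> n")
    case True
    then have "(1 - p) ^ (n - k) = (1 - p) * (1 - p) ^ (n - Suc k)"
      by (metis Suc_diff_Suc Suc_le_lessD power_Suc)
    then show ?thesis using assms by (simp add: bin_mass_def distrib_left distrib_right mult_ac)
  next
    case False
    then show ?thesis using assms by (simp add: bin_mass_def binomial_eq_0)
  qed
qed

lemma bin_cdf_eq_sum: "bin_cdf m n p = (\<Sum>k\<le>m. bin_mass k n p)"
  unfolding bin_cdf_def bin_mass_def by (simp add: measure_measure_pmf_finite)

lemma bin_cdf_nonneg: "0 \<le> bin_cdf m n p" and bin_cdf_le_1: "bin_cdf m n p \<le> 1"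
  unfolding bin_cdf_def by simp_all

text \<open>One more trial pushes the count beyond \<open>m\<close> only if the count is exactly
  \<open>m\<close> and the trial succeeds.\<close>

lemma bin_cdf_Suc:
  assumes "0 \<le> p" "p \<le> 1"
  shows "bin_cdf m (Suc n) p = bin_cdf m n p - p * bin_mass m n p"
proof (induction m)
  case 0
  then show ?case using assms by (simp add: bin_cdf_eq_sum bin_mass_Suc algebra_simps)
next
  case (Suc m)
  then show ?case using assms by (simp add: bin_cdf_eq_sum bin_mass_Suc algebra_simps)
qed

lemma bin_cdf_eq_1:
  assumes "0 \<le> p" "p \<le> 1" "n \<le> m"
  shows "bin_cdf m n p = 1"
proof -
  have "set_pmf (binomial_pmf n p) \<subseteq> {..m}"
    using assms by (auto simp: set_pmf_binomial_eq split: if_splits)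
  then show ?thesis unfolding bin_cdf_def by (simp add: measure_pmf.prob_eq_1 AE_measure_pmf_iff subset_iff)
qed

text \<open>The expected shortfall of a binomial count below \<open>Suc m\<close>. It starts at
  \<open>Suc m\<close>, and each further trial lowers it by 1 exactly when it succeeds while the
  count so far is at most \<open>m\<close>.\<close>

lemma bin_shortfall:
  assumes "0 \<le> p" "p \<le> 1"
  shows "(\<Sum>k\<le>m. (real (Suc m) - real k) * bin_mass k n p) = real (Suc m) - p * (\<Sum>i<n. bin_cdf m i p)"
proof -
  \<comment> \<open>Layer-cake form: \<open>Suc m - k\<close> is the number of levels
    \<open>l\<close> in \<open>{k..m}\<close>.\<close>
  have eq: "(\<Sum>k\<le>m. (real (Suc m) - real k) * bin_mass k n p) = (\<Sum>l\<le>m. bin_cdf l n p)" for n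
  proof (induction m)
    case (Suc m)
    have "(\<Sum>k\<le>Suc m. (real (Suc (Suc m)) - real k) * bin_mass k n p)
        = (\<Sum>k\<le>Suc m. (real (Suc m) - real k) * bin_mass k n p + bin_mass k n p)"
      by (intro sum.cong) (auto simp: algebra_simps)
    also have "\<dots> = (\<Sum>k\<le>m. (real (Suc m) - real k) * bin_mass k n p) + bin_cdf (Suc m) n p"
      by (simp add: sum.distrib bin_cdf_eq_sum)
    finally show ?case using Suc by simp
  qed (simp add: bin_cdf_eq_sum)
  have "(\<Sum>l\<le>m. bin_cdf l n p) = real (Suc m) - p * (\<Sum>i<n. bin_cdf m i p)"
  proof (induction n)
    case 0
    then show ?case using assms by (simp add: bin_cdf_eq_1)
  next
    case (Suc n)
    have "(\<Sum>l\<le>m. bin_cdf l (Suc n) p) = (\<Sum>l\<le>m. bin_cdf l n p) - p * bin_cdf m n p"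
      using assms by (simp add: bin_cdf_Suc sum_subtractf bin_cdf_eq_sum[of m] sum_distrib_left)
    then show ?case using Suc by (simp add: algebra_simps)
  qed
  then show ?thesis unfolding eq .
qed

text \<open>Keeping each of a Poisson number of points with mean \<open>y\<close> independently with
  probability \<open>p\<close> leaves a Poisson number with mean \<open>p * y\<close>.\<close>

lemma pois_thinning:
  assumes "0 \<le> p" "p \<le> 1"
  shows "(\<lambda>i. bin_mass k i p * pois i y) sums pois k (p * y)"
proof -
  \<comment> \<open>Of the \<open>i + k\<close> points, \<open>k\<close> are kept and
    \<open>i\<close> discarded; the discarded ones form an exponential series in
    \<open>(1 - p) * y\<close>.\<close>
  have "bin_mass k (i + k) p * pois (i + k) y = pois k (p * y) * exp (- ((1 - p) * y)) * (((1 - p) * y) ^ i /\<^sub>R fact i)" for i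
  proof -
    have "real ((i + k) choose k) = fact (i + k) / (fact k * fact i)"
      by (subst binomial_fact) auto
    moreover have "exp (- y) = exp (- (p * y)) * exp (- ((1 - p) * y))"
      by (simp add: exp_add[symmetric] algebra_simps)
    ultimately show ?thesis
      using assms by (simp add: bin_mass_def pois_def power_add power_mult_distrib divide_inverse)
  qed
  moreover have "(\<lambda>i. pois k (p * y) * exp (- ((1 - p) * y)) * (((1 - p) * y) ^ i /\<^sub>R fact i))
      sums (pois k (p * y) * exp (- ((1 - p) * y)) * exp ((1 - p) * y))"
    by (intro sums_mult exp_converges)
  moreover have "pois k (p * y) * exp (- ((1 - p) * y)) * exp ((1 - p) * y) = pois k (p * y)"
    using exp_minus_inverse[of "(1 - p) * y"] by (simp add: mult.assoc mult.commute)
  ultimately have "(\<lambda>i. bin_mass k (i + k) p * pois (i + k) y) sums pois k (p * y)"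
    by simp
  moreover have "(\<Sum>i<k. bin_mass k i p * pois i y) = 0"
    using assms by (intro sum.neutral) (auto simp: bin_mass_def binomial_eq_0)
  ultimately show ?thesis using sums_iff_shift[of "\<lambda>i. bin_mass k i p * pois i y" k] by simp
qed

lemma bin_cdf_pois_sums:
  assumes "0 \<le> p" "p \<le> 1"
  shows "(\<lambda>i. bin_cdf m i p * pois i y) sums (\<Sum>k\<le>m. pois k (p * y))"
  unfolding bin_cdf_eq_sum sum_distrib_right by (intro sums_sum pois_thinning assms)

section \<open>The Erlang distribution and sums over the atoms\<close>

lemma real_distribution_erlang:
  assumes "1 \<le> \<xi>"
  shows "real_distribution (erlang_dist \<xi>)"
  using assms prob_space_erlang_density[of "real \<xi>" "\<xi> - 1"]
  by (simp add: real_distribution_def real_distribution_axioms_def erlang_dist_def)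

lemma
  assumes "1 \<le> \<xi>"
  shows nonneg_distribution_erlang: "nonneg_distribution (erlang_dist \<xi>)"
    and dist_mean_erlang: "dist_mean (erlang_dist \<xi>) = 1"
proof -
  interpret real_distribution "erlang_dist \<xi>" by (rule real_distribution_erlang) fact
  have "distr (erlang_dist \<xi>) lborel (\<lambda>x. x) = distr (erlang_dist \<xi>) (erlang_dist \<xi>) (\<lambda>x. x)"
    by (rule distr_cong) auto
  then have D: "distributed (erlang_dist \<xi>) lborel (\<lambda>x. x) (erlang_density (\<xi> - 1) (real \<xi>))"
    unfolding distributed_def by (simp add: distr_id) (simp add: erlang_dist_def)
  have \<xi>: "0 < real \<xi>" using assms by simp
  have "expectation (\<lambda>x. x) = fact (\<xi> - 1 + 1) / (fact (\<xi> - 1) * real \<xi>)"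
    using erlang_ith_moment[OF \<xi> D, of 1] by simp
  also have "\<dots> = 1" using assms by (simp add: fact_reduce)
  finally show mean: "dist_mean (erlang_dist \<xi>) = 1" by (simp add: dist_mean_def)
  show "nonneg_distribution (erlang_dist \<xi>)"
  proof
    show "AE x in erlang_dist \<xi>. 0 \<le> x"
      unfolding erlang_dist_def by (subst AE_density) (auto simp: erlang_density_def)
    show "integrable (erlang_dist \<xi>) (\<lambda>x. x)"
      using erlang_ith_moment_integrable[OF \<xi> D, of 1] by simp
  qed (simp add: mean)
qed

text \<open>The \<open>\<xi>\<close>-th arrival of a Poisson process of rate \<open>\<xi>\<close>
  comes after \<open>x\<close> iff at most \<open>\<xi> - 1\<close> arrivals occur by
  \<open>x\<close>.\<close>

lemma tail_erlang_dist:
  assumes "1 \<le> \<xi>" "0 \<le> x"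
  shows "1 - cdf (erlang_dist \<xi>) x = (\<Sum>k\<le>\<xi> - 1. pois k (real \<xi> * x))"
proof -
  interpret real_distribution "erlang_dist \<xi>" by (rule real_distribution_erlang) fact
  have "0 < real \<xi>" using assms by simp
  then have "ennreal (cdf (erlang_dist \<xi>) x) = ennreal (erlang_CDF (\<xi> - 1) (real \<xi>) x)"
    using emeasure_erlang_density[of "real \<xi>" "\<xi> - 1" x]
    by (simp add: cdf_def emeasure_eq_measure[symmetric]) (simp add: erlang_dist_def)
  then have "cdf (erlang_dist \<xi>) x = erlang_CDF (\<xi> - 1) (real \<xi>) x"
    using \<open>0 < real \<xi>\<close> by (simp add: cdf_nonneg)
  then show ?thesis using assms by (simp add: erlang_CDF_def pois_def)
qed

text \<open>Pulling \<open>P\<close> back along \<open>s\<close> to a distribution on the naturals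
  turns the integral into one over a counting measure, that is, an absolutely convergent series in
  the order of the enumeration.\<close>

lemma pmf_sums_integral:
  fixes g :: "real \<Rightarrow> real"
  assumes "inj s" "set_pmf P = range s" and g: "integrable (measure_pmf P) g"
  shows "(\<lambda>j::nat. pmf P (s j) * g (s j)) sums (\<integral>x. g x \<partial>measure_pmf P)"
proof -
  define N where "N = map_pmf (inv s) P"
  have "map_pmf s N = map_pmf (\<lambda>x. x) P"
    unfolding N_def map_pmf_comp by (rule map_pmf_cong) (auto simp: assms f_inv_into_f)
  then have P: "P = map_pmf s N" by simp
  have N: "pmf N j = pmf P (s j)" for j
    unfolding P by (rule pmf_map_inj'[symmetric]) fact
  have "integrable (measure_pmf N) (\<lambda>j. g (s j))"
    using g unfolding P by simp
  then have "integrable (count_space UNIV) (\<lambda>j. pmf N j *\<^sub>R g (s j))"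
    unfolding measure_pmf_eq_density by (subst (asm) integrable_density) auto
  from sums_integral_count_space_nat[OF this]
  have "(\<lambda>j. pmf N j * g (s j)) sums (\<integral>j. pmf N j *\<^sub>R g (s j) \<partial>count_space UNIV)" by simp
  also have "(\<integral>j. pmf N j *\<^sub>R g (s j) \<partial>count_space UNIV) = (\<integral>j. g (s j) \<partial>measure_pmf N)"
    unfolding measure_pmf_eq_density[of N] by (subst integral_density) auto
  also have "\<dots> = (\<integral>x. g x \<partial>measure_pmf P)"
    unfolding P by simp
  finally show ?thesis by (simp add: N)
qed

section \<open>Erlang mixtures and the recursion for the coefficients\<close>

locale erlang_mixture =
  fixes P :: "real pmf" and s :: "nat \<Rightarrow> real" and \<xi> :: nat
  assumes s_0: "0 < s 0" and mono_s: "strict_mono s" and set_P: "set_pmf P = range s"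
    and int_P: "integrable (measure_pmf P) (\<lambda>x. x)"
    and \<xi>: "1 \<le> \<xi>"
begin

lemma AE_ge_s_0: "AE x in P. s 0 \<le> x"
  using strict_mono_less_eq[OF mono_s] by (auto simp: AE_measure_pmf_iff set_P)

sublocale positive_mixing "measure_pmf P"
proof
  show "AE x in P. 0 < x" using AE_ge_s_0 by eventually_elim (use s_0 in auto)
qed simp

lemma s_0_le: "s 0 \<le> s j"
  using strict_mono_less_eq[OF mono_s] by simp

lemma s_0_div: "s 0 \<le> x \<Longrightarrow> 0 \<le> s 0 / x \<and> s 0 / x \<le> 1"
  using s_0 by simp

lemma C_coeff_eq_integral: "C_coeff P s \<xi> i = (\<integral>x. bin_cdf (\<xi> - 1) i (s 0 / x) \<partial>P)"
  unfolding C_coeff_def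
  by (intro sums_unique[symmetric] pmf_sums_integral[OF strict_mono_imp_inj_on[OF mono_s] set_P]
      measure_pmf.integrable_const_bound[where B = 1]) (auto simp: bin_cdf_nonneg bin_cdf_le_1)

lemma C_coeff_nonneg: "0 \<le> C_coeff P s \<xi> i"
  unfolding C_coeff_eq_integral by (simp add: bin_cdf_nonneg)

lemma C_coeff_le_1: "C_coeff P s \<xi> i \<le> 1"
  unfolding C_coeff_eq_integral
  by (intro measure_pmf.integral_le_const measure_pmf.integrable_const_bound[where B = 1]) (auto simp: bin_cdf_nonneg bin_cdf_le_1)

text \<open>Fewer than \<open>\<xi>\<close> trials cannot give more than \<open>\<xi> - 1\<close>
  successes. This is the source of the closed form of \<open>kappa\<close> up to index
  \<open>\<xi>\<close>.\<close>

lemma C_coeff_eq_1: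
  assumes "i < \<xi>"
  shows "C_coeff P s \<xi> i = 1"
proof -
  have "C_coeff P s \<xi> i = (\<integral>x. 1 \<partial>P)"
    unfolding C_coeff_eq_integral using AE_ge_s_0 s_0_div assms
    by (intro integral_cong_AE) (auto elim!: eventually_mono intro!: bin_cdf_eq_1)
  then show ?thesis by simp
qed

text \<open>For an atom \<open>x\<close>, \<open>bin_shortfall\<close> applies with
  \<open>m = \<xi> - 1\<close> and \<open>p = s 0 / x\<close>; the weight \<open>x\<close> cancels
  the denominator of \<open>p\<close>, so the subtracted term averages to a sum of
  \<open>C_coeff\<close> values.\<close>

lemma D_coeff_eq: "D_coeff P s \<xi> n = dist_mean P - s 0 / real \<xi> * (\<Sum>i<n. C_coeff P s \<xi> i)"
proof -
  define E where "E x = x - s 0 / real \<xi> * (\<Sum>i<n. bin_cdf (\<xi> - 1) i (s 0 / x))" for x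
  have shortfall: "x * (\<Sum>k=0..\<xi> - 1. (real \<xi> - real k) / real \<xi> * bin_mass k n (s 0 / x)) = E x"
    if "s 0 \<le> x" for x
  proof -
    have "(\<Sum>k=0..\<xi> - 1. (real \<xi> - real k) / real \<xi> * bin_mass k n (s 0 / x))
        = (\<Sum>k\<le>\<xi> - 1. (real (Suc (\<xi> - 1)) - real k) * bin_mass k n (s 0 / x)) / real \<xi>"
      using \<xi> by (simp add: sum_divide_distrib atLeast0AtMost)
    also have "\<dots> = (real \<xi> - s 0 / x * (\<Sum>i<n. bin_cdf (\<xi> - 1) i (s 0 / x))) / real \<xi>"
      using s_0_div[OF that] \<xi> by (subst bin_shortfall) auto
    finally show ?thesis using that s_0 \<xi> by (simp add: E_def field_simps)
  qed
  have int: "integrable P (\<lambda>x. bin_cdf (\<xi> - 1) i (s 0 / x))" for i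
    by (intro measure_pmf.integrable_const_bound[where B = 1]) (auto simp: bin_cdf_nonneg bin_cdf_le_1)
  have "D_coeff P s \<xi> n = (\<Sum>j. pmf P (s j) * E (s j))"
    unfolding D_coeff_def
    using shortfall[OF s_0_le] by (simp only: mult.assoc)
  also have "\<dots> = (\<integral>x. E x \<partial>P)"
    unfolding E_def
    by (intro sums_unique[symmetric] pmf_sums_integral[OF strict_mono_imp_inj_on[OF mono_s] set_P]
      Bochner_Integration.integrable_diff int_P integrable_mult_right Bochner_Integration.integrable_sum int)
  also have "\<dots> = dist_mean P - s 0 / real \<xi> * (\<Sum>i<n. C_coeff P s \<xi> i)"
    unfolding E_def dist_mean_def C_coeff_eq_integral
    using int int_P by simp
  finally show ?thesis .
qed

text \<open>For an atom \<open>z\<close>, the Erlang tail at \<open>x / z\<close> is a Poisson sum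
  with mean \<open>p * y\<close>, where \<open>p = s 0 / z\<close> and
  \<open>y = \<xi> * x / s 0\<close>. Thinning re-expands it in weights at the common
  \<open>y\<close>, and nonnegativity allows averaging over \<open>P\<close> term by term.\<close>

lemma tail_pois_sums:
  assumes x: "0 \<le> x"
  shows "(\<lambda>i. C_coeff P s \<xi> i * pois i (real \<xi> / s 0 * x)) sums (1 - cdf (scale_mixture P (erlang_dist \<xi>)) x)"
proof -
  define y where "y = real \<xi> / s 0 * x"
  have "0 \<le> y" using x s_0 by (simp add: y_def)
  interpret G: real_distribution "erlang_dist \<xi>" by (rule real_distribution_erlang[OF \<xi>])
  interpret F: real_distribution "scale_mixture P (erlang_dist \<xi>)"
    by (rule real_distribution_scale_mixture) (rule G.real_distribution_axioms)
  have int: "integrable P (\<lambda>z. cdf (erlang_dist \<xi>) (x / z))"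
    by (intro measure_pmf.integrable_const_bound[where B = 1]) (auto simp: G.cdf_nonneg G.cdf_bounded_prob)
  have intC: "integrable P (\<lambda>z. bin_cdf (\<xi> - 1) i (s 0 / z) * pois i y)" for i
    by (intro integrable_mult_left measure_pmf.integrable_const_bound[where B = 1]) (auto simp: bin_cdf_nonneg bin_cdf_le_1)
  have sums: "(\<lambda>i. bin_cdf (\<xi> - 1) i (s 0 / z) * pois i y) sums (1 - cdf (erlang_dist \<xi>) (x / z))"
    if "s 0 \<le> z" for z
  proof -
    have "s 0 / z * y = real \<xi> * (x / z)" using s_0 that by (simp add: y_def)
    then show ?thesis
      using bin_cdf_pois_sums[of "s 0 / z" "\<xi> - 1" y] s_0_div[OF that] tail_erlang_dist[OF \<xi>, of "x / z"] x s_0 that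
      by simp
  qed
  have "ennreal (1 - cdf (scale_mixture P (erlang_dist \<xi>)) x)
      = ennreal (\<integral>z. 1 - cdf (erlang_dist \<xi>) (x / z) \<partial>P)"
    using int by (simp add: cdf_scale_mixture[OF G.real_distribution_axioms])
  also have "\<dots> = (\<integral>\<^sup>+z. ennreal (1 - cdf (erlang_dist \<xi>) (x / z)) \<partial>P)"
    using int by (intro nn_integral_eq_integral[symmetric]) (auto simp: G.cdf_bounded_prob)
  also have "\<dots> = (\<integral>\<^sup>+z. (\<Sum>i. ennreal (bin_cdf (\<xi> - 1) i (s 0 / z) * pois i y)) \<partial>P)"
    using AE_ge_s_0
  proof (intro nn_integral_cong_AE, eventually_elim)
    case (elim z)
    have "(\<lambda>i. ennreal (bin_cdf (\<xi> - 1) i (s 0 / z) * pois i y)) sums ennreal (1 - cdf (erlang_dist \<xi>) (x / z))"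
      using sums[of z] elim \<open>0 \<le> y\<close>
      by (subst sums_ennreal) (auto simp: bin_cdf_nonneg pois_nonneg G.cdf_bounded_prob)
    then show ?case by (rule sums_unique)
  qed
  also have "\<dots> = (\<Sum>i. \<integral>\<^sup>+z. ennreal (bin_cdf (\<xi> - 1) i (s 0 / z) * pois i y) \<partial>P)"
    by (rule nn_integral_suminf) simp
  also have "\<dots> = (\<Sum>i. ennreal (C_coeff P s \<xi> i * pois i y))"
    using intC \<open>0 \<le> y\<close>
    by (intro suminf_cong, subst nn_integral_eq_integral)
      (auto simp: bin_cdf_nonneg pois_nonneg C_coeff_eq_integral)
  finally have "(\<lambda>i. ennreal (C_coeff P s \<xi> i * pois i y)) sums ennreal (1 - cdf (scale_mixture P (erlang_dist \<xi>)) x)"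
    using summable_sums[OF summableI, of "\<lambda>i. ennreal (C_coeff P s \<xi> i * pois i y)"] by simp
  then show ?thesis
    unfolding y_def[symmetric] using \<open>0 \<le> y\<close>
    by (subst (asm) sums_ennreal) (auto simp: C_coeff_nonneg pois_nonneg F.cdf_bounded_prob)
qed

text \<open>Both branches of \<open>kappa\<close> satisfy this one recursion: up to
  \<open>\<xi>\<close> it sums a geometric progression because the \<open>C_coeff\<close> factors
  are 1, beyond \<open>\<xi>\<close> it follows from \<open>D_coeff_eq\<close>.\<close>

lemma one_minus_kappa_rec:
  assumes "0 < \<gamma> * m"
  defines "a \<equiv> \<gamma> * m * s 0 / (dist_mean P * real \<xi>)"
  shows "1 - kappa \<gamma> m P s \<xi> n
    = (1 - \<gamma> * m) + a * (\<Sum>i<n. C_coeff P s \<xi> i * (1 - kappa \<gamma> m P s \<xi> (n - 1 - i)))"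
proof -
  have mean: "0 < dist_mean P" by (rule dist_mean_pos) (rule int_P)
  have "0 < a" using assms s_0 mean \<xi> by (simp add: a_def)
  \<comment> \<open>Index 0 fits the geometric form too, since \<open>1 - \<gamma> * m\<close> is
    its value at exponent 0.\<close>
  have small: "1 - kappa \<gamma> m P s \<xi> n = (1 - \<gamma> * m) * (1 + a) ^ n" if "n \<le> \<xi>" for n
    using that by (subst kappa.simps) (auto simp: a_def algebra_simps)
  show ?thesis
  proof (cases "n \<le> \<xi>")
    case True
    have "a * (\<Sum>i<n. C_coeff P s \<xi> i * (1 - kappa \<gamma> m P s \<xi> (n - 1 - i)))
        = a * (\<Sum>i<n. (1 - \<gamma> * m) * (1 + a) ^ (n - Suc i))"
      using True by (intro arg_cong[where f = "(*) a"] sum.cong) (auto simp: C_coeff_eq_1 small)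
    also have "\<dots> = (1 - \<gamma> * m) * (a * (\<Sum>i<n. (1 + a) ^ i))"
      using sum.nat_diff_reindex[of "\<lambda>i. (1 + a) ^ i" n] by (simp add: sum_distrib_left[symmetric])
    also have "a * (\<Sum>i<n. (1 + a) ^ i) = (1 + a) ^ n - 1"
      using power_diff_1_eq[of "1 + a" n] by simp
    finally show ?thesis using small[OF True] by (simp add: algebra_simps)
  next
    case False
    have "kappa \<gamma> m P s \<xi> n = a * (\<Sum>i<n. kappa \<gamma> m P s \<xi> (n - 1 - i) * C_coeff P s \<xi> i)
        + \<gamma> * m / dist_mean P * D_coeff P s \<xi> n"
      using False by (subst kappa.simps) (simp add: a_def)
    \<comment> \<open>The subtracted sum of \<open>C_coeff\<close> values combines with the sum of
      \<open>kappa\<close> terms into factors \<open>1 - kappa\<close>.\<close>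
    also have "\<gamma> * m / dist_mean P * D_coeff P s \<xi> n = \<gamma> * m - a * (\<Sum>i<n. C_coeff P s \<xi> i)"
      using mean \<xi> by (simp add: D_coeff_eq a_def field_simps)
    finally show ?thesis
      by (simp add: right_diff_distrib sum_subtractf mult.commute)
  qed
qed

text \<open>Since \<open>C_coeff\<close> lies between 0 and 1, the recursion preserves nonnegativity
  and is dominated by the geometric one with ratio \<open>1 + a\<close>.\<close>

lemma one_minus_kappa_bounds:
  assumes "0 < \<gamma> * m" "\<gamma> * m < 1"
  defines "a \<equiv> \<gamma> * m * s 0 / (dist_mean P * real \<xi>)"
  shows "0 \<le> 1 - kappa \<gamma> m P s \<xi> n \<and> 1 - kappa \<gamma> m P s \<xi> n \<le> (1 + a) ^ n"
proof (induction n rule: less_induct)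
  case (less n)
  have "0 < dist_mean P" by (rule dist_mean_pos) (rule int_P)
  then have "0 < a" using assms s_0 \<xi> by (simp add: a_def)
  have bnd: "0 \<le> C_coeff P s \<xi> i * (1 - kappa \<gamma> m P s \<xi> (n - 1 - i))
      \<and> C_coeff P s \<xi> i * (1 - kappa \<gamma> m P s \<xi> (n - 1 - i)) \<le> (1 + a) ^ (n - Suc i)" if "i < n" for i
    using less.IH[of "n - 1 - i"] that C_coeff_nonneg[of i] C_coeff_le_1[of i]
      mult_mono[of "C_coeff P s \<xi> i" 1 "1 - kappa \<gamma> m P s \<xi> (n - 1 - i)" "(1 + a) ^ (n - Suc i)"]
    by auto
  have "a * (\<Sum>i<n. C_coeff P s \<xi> i * (1 - kappa \<gamma> m P s \<xi> (n - 1 - i))) \<le> a * (\<Sum>i<n. (1 + a) ^ (n - Suc i))"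
    using \<open>0 < a\<close> bnd by (intro mult_left_mono sum_mono) auto
  also have "\<dots> = (1 + a) ^ n - 1"
    using sum.nat_diff_reindex[of "\<lambda>i. (1 + a) ^ i" n] power_diff_1_eq[of "1 + a" n] by simp
  finally have "a * (\<Sum>i<n. C_coeff P s \<xi> i * (1 - kappa \<gamma> m P s \<xi> (n - 1 - i))) \<le> (1 + a) ^ n - 1" .
  moreover have "0 \<le> a * (\<Sum>i<n. C_coeff P s \<xi> i * (1 - kappa \<gamma> m P s \<xi> (n - 1 - i)))"
    using \<open>0 < a\<close> bnd by (auto intro!: mult_nonneg_nonneg[of a] sum_nonneg)
  ultimately show ?case
    using one_minus_kappa_rec[OF assms(1), of n, folded a_def] assms by linarith
qed

end

text \<open>\<open>sums\<close> asserts convergence along with the value; the first conjunct ties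
  \<open>pk_ruin\<close> to the process, so the expansion also represents its ruin
  probability.\<close>

theorem theorem3p5:
  fixes P :: "real pmf" and s :: "nat \<Rightarrow> real" and \<xi> :: nat and \<gamma> \<mu>\<^sub>F u :: real
    and M :: "'a measure" and W X :: "nat \<Rightarrow> 'a \<Rightarrow> real"
  assumes "0 < s 0" and "strict_mono s" and "set_pmf P = range s"
    and "integrable (measure_pmf P) (\<lambda>x. x)"
    and "1 \<le> \<xi>"
    and "0 < \<gamma>" and "0 < \<mu>\<^sub>F" and "\<gamma> * \<mu>\<^sub>F < 1"
    and "cramer_lundberg M (\<gamma> * \<mu>\<^sub>F / dist_mean P) (scale_mixture P (erlang_dist \<xi>)) W X"
    and "0 \<le> u"
  defines "H \<equiv> scale_mixture (moment_distribution P) (integrated_tail (erlang_dist \<xi>))"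
  shows "ruin_prob M W X u = pk_ruin (\<gamma> * \<mu>\<^sub>F) H u \<and>
    (\<lambda>n. kappa \<gamma> \<mu>\<^sub>F P s \<xi> n *
        ((real \<xi> * u / s 0) ^ n * exp (- (real \<xi> * u / s 0)) / fact n))
      sums pk_ruin (\<gamma> * \<mu>\<^sub>F) H u"
proof -
  let ?F = "scale_mixture P (erlang_dist \<xi>)"
  interpret erlang_mixture P s \<xi> by standard fact+
  interpret G: nonneg_distribution "erlang_dist \<xi>" by (rule nonneg_distribution_erlang) fact
  interpret CL: cramer_lundberg M "\<gamma> * \<mu>\<^sub>F / dist_mean P" ?F W X by fact
  have mean: "0 < dist_mean P" by (rule dist_mean_pos) fact
  have mean_F: "dist_mean ?F = dist_mean P"
    using dist_mean_scale_mixture[OF G.real_distribution_axioms int_P G.integrable_id] dist_mean_erlang[OF \<xi>]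
    by simp
  interpret F: nonneg_distribution ?F
  proof (intro nonneg_distribution.intro nonneg_distribution_axioms.intro)
    show "real_distribution ?F" by (rule real_distribution_scale_mixture) (rule G.real_distribution_axioms)
    \<comment> \<open>\<open>claim_nonneg\<close> transfers because \<open>?F\<close> is the law of
      \<open>X 0\<close>.\<close>
    show "AE x in ?F. 0 \<le> x"
      unfolding CL.claim_dist[of 0, symmetric] by (subst AE_distr_iff) (auto simp: CL.claim_nonneg)
    show "integrable ?F (\<lambda>x. x)"
      by (rule integrable_scale_mixture[OF G.real_distribution_axioms int_P G.integrable_id])
    show "0 < dist_mean ?F" using mean mean_F by simp
  qed
  interpret CL: finite_mean_cramer_lundberg M "\<gamma> * \<mu>\<^sub>F / dist_mean P" ?F W X ..
  have \<rho>: "CL.\<rho> = \<gamma> * \<mu>\<^sub>F" using mean by (simp add: CL.\<rho>_def mean_F)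
  have H: "H = integrated_tail ?F"
    unfolding H_def
    by (rule scale_mixture_integrated_tail[OF int_P G.nonneg_distribution_axioms F.nonneg_distribution_axioms])
  define \<theta> where "\<theta> = real \<xi> / s 0"
  define a where "a = \<gamma> * \<mu>\<^sub>F * s 0 / (dist_mean P * real \<xi>)"
  define \<eta> where "\<eta> n = 1 - kappa \<gamma> \<mu>\<^sub>F P s \<xi> n" for n
  define \<Phi> where "\<Phi> v = (\<Sum>n. \<eta> n * pois n (\<theta> * v))" for v
  have pos: "0 < \<gamma> * \<mu>\<^sub>F" using assms by simp
  have "0 < \<theta>" using \<xi> s_0 by (simp add: \<theta>_def)
  have "0 < a" using pos mean \<xi> s_0 by (simp add: a_def)
  \<comment> \<open>The constant \<open>a\<close> of the recursion is the Poisson intensity divided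
    by \<open>\<theta>\<close>.\<close>
  have \<eta>_rec: "\<eta> n = (1 - \<gamma> * \<mu>\<^sub>F)
      + \<gamma> * \<mu>\<^sub>F / dist_mean P / \<theta> * (\<Sum>i<n. C_coeff P s \<xi> i * \<eta> (n - 1 - i))" for n
    using one_minus_kappa_rec[OF pos, of n] by (simp add: \<eta>_def \<theta>_def)
  have kern: "(\<lambda>i. \<gamma> * \<mu>\<^sub>F / dist_mean P * (C_coeff P s \<xi> i * pois i (\<theta> * x))) sums CL.kern x" if "0 \<le> x" for x
    unfolding CL.kern_def \<theta>_def by (intro sums_mult tail_pois_sums that)
  note bounds = one_minus_kappa_bounds[OF pos assms(8), folded a_def \<eta>_def]
  have \<Phi>: "\<Phi> \<in> borel_measurable borel"
    "\<And>v. 0 \<le> v \<Longrightarrow> (\<lambda>n. \<eta> n * pois n (\<theta> * v)) sums \<Phi> v"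
    "\<And>v. 0 \<le> v \<Longrightarrow> 0 \<le> \<Phi> v"
    "\<And>v. 0 \<le> v \<Longrightarrow> v \<le> w \<Longrightarrow> \<Phi> v \<le> exp ((1 + a) * (\<theta> * w))"
    "\<Phi> w = (1 - \<gamma> * \<mu>\<^sub>F) + volterra CL.kern \<Phi> w" if "0 \<le> w" for w
    using pois_mixture_renewal[of \<theta> "\<gamma> * \<mu>\<^sub>F / dist_mean P" "1 - \<gamma> * \<mu>\<^sub>F" "C_coeff P s \<xi>" \<eta> "1 + a" CL.kern w,
        OF _ _ _ C_coeff_nonneg C_coeff_le_1 _ _ _ \<eta>_rec CL.measurable_kern kern that]
      \<open>0 < \<theta>\<close> pos mean assms(8) bounds \<open>0 < a\<close>
    unfolding \<Phi>_def by auto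
  \<comment> \<open>A solution is a stationary Picard iteration, so its convergence to
    \<open>CL.survival u\<close> is an equality.\<close>
  have "(\<lambda>n::nat. \<Phi> u) \<longlonglongrightarrow> CL.survival u"
  proof (rule picard_iteration_tendsto[where k = CL.kern and f = CL.survival and g = "\<lambda>_. \<Phi>" and u = u
        and c = "1 - \<gamma> * \<mu>\<^sub>F" and B = 1 and B' = "exp ((1 + a) * (\<theta> * u))"])
    show "(LBINT x:{0..}. CL.kern x) < 1" using assms(8) by (simp add: CL.kern_set_integral \<rho>)
    show "CL.survival v = 1 - \<gamma> * \<mu>\<^sub>F + volterra CL.kern CL.survival v" if "0 \<le> v" for v
      using CL.survival_renewal[OF _ that] assms(8) by (simp add: \<rho>)
    show "\<Phi> v = 1 - \<gamma> * \<mu>\<^sub>F + volterra CL.kern \<Phi> v" if "0 \<le> v" for v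
      using that by (rule \<Phi>)
  qed (use \<open>0 \<le> u\<close> \<Phi>[OF \<open>0 \<le> u\<close>] in \<open>auto simp: CL.kern_nonneg CL.kern_set_integrable
      CL.survival_nonneg CL.survival_le_1\<close>)
  then have "\<Phi> u = CL.survival u" by (simp add: LIMSEQ_const_iff)
  moreover have "pk_ruin (\<gamma> * \<mu>\<^sub>F) H u = 1 - CL.survival u"
    using CL.pk_ruin_eq_survival[OF _ \<open>0 \<le> u\<close>] assms(8) by (simp add: \<rho> H)
  moreover have "(\<lambda>n. kappa \<gamma> \<mu>\<^sub>F P s \<xi> n * pois n (\<theta> * u)) sums (1 - \<Phi> u)"
    using sums_diff[OF pois_sums[of "\<theta> * u"] \<Phi>(2)[OF \<open>0 \<le> u\<close> \<open>0 \<le> u\<close>]] by (simp add: \<eta>_def left_diff_distrib)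
  moreover have "ruin_prob M W X u = pk_ruin (\<gamma> * \<mu>\<^sub>F) H u"
    using CL.pollaczek_khinchine[OF _ \<open>0 \<le> u\<close>] assms(8) by (simp add: \<rho> H)
  ultimately show ?thesis by (simp add: pois_def \<theta>_def)
qed

end
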